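(* Let $(X,d,\alpha)$ be a computable metric space. Let $S$ be a semi-computable compact set in this space such that $S$, as a subspace of $(X,d)$, is a manifold. Then $S$ is a computable compact set in $(X,d,\alpha)$.
   Context: A computable metric space is a triple $(X,d,\alpha)$ where $(X,d)$ is a metric space and $\alpha=(\alpha_i)_{i\in\mathbb N}$ is a sequence with dense range in $(X,d)$ such that $(i,j)\mapsto d(\alpha_i,\alpha_j)$ is a computable function $\mathbb N^2\to\mathbb R$ (a function $g:\mathbb N^k\to\mathbb R$ is computable if there is a computable $G:\mathbb N^{k+1}\to\mathbb Q$ with $|g(x)-G(x,i)|<2^{-i}$ for all $x,i$). Fix a computable $q:\mathbb N\to\mathbb Q$ whose image is the set of positive rationals and computable $\tau_1,\tau_2:\mathbb N\to\mathbb N$ with $\{(\tau_1(i),\tau_2(i)):i\in\mathbb N\}=\mathbb N^2$; let $\lambda_i=\alpha_{\tau_1(i)}$, $\rho_i=q_{\tau_2(i)}$, $I_i=B(\lambda_i,\rho_i)$ (open ball). Fix computable $\sigma:\mathbb N^2\to\mathbb N$, $\eta:\mathbb N\to\mathbb N$ such that $\{(\sigma(j,0),\dots,\sigma(j,\eta(j))):j\in\mathbb N\}$ is the set of all nonempty finite sequences in $\mathbb N$; let $[j]=\{\sigma(j,i):0\le i\le\eta(j)\}$ and $J_j=\bigcup_{i\in[j]}I_i$. A set $K\subseteq X$ is a semi-computable compact set if $K$ is compact in $(X,d)$ and $\{j\in\mathbb N: K\subseteq J_j\}$ is computably enumerable; it is a computable compact set if moreover $\{i\in\mathbb N: K\cap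 I_i\neq\emptyset\}$ is computably enumerable. A manifold is a nonempty topological space which, for some $n\ge1$, has each point possessing a neighborhood homeomorphic to $\mathbb R^n$. *)

theory Defs
  imports "HOL-Analysis.Analysis"
begin

datatype recf = Zero | Succ | Proj nat | Comp recf "recf list" | Prim recf recf | Mini recf

inductive eval :: "recf \<Rightarrow> nat list \<Rightarrow> nat \<Rightarrow> bool" where
  eval_Zero: "eval Zero xs 0"
| eval_Succ: "eval Succ (x # xs) (Suc x)"
| eval_Proj: "i < length xs \<Longrightarrow> eval (Proj i) xs (xs ! i)"
| eval_Comp: "length ys = length gs \<Longrightarrow> (\<forall>i<length gs. eval (gs ! i) xs (ys ! i))
      \<Longrightarrow> eval f ys z \<Longrightarrow> eval (Comp f gs) xs z"
| eval_Prim0: "eval f xs z \<Longrightarrow> eval (Prim f g) (0 # xs) z"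
| eval_PrimS: "eval (Prim f g) (n # xs) y \<Longrightarrow> eval g (y # n # xs) z
      \<Longrightarrow> eval (Prim f g) (Suc n # xs) z"
| eval_Mini: "eval f (n # xs) 0 \<Longrightarrow> (\<forall>m<n. \<exists>y>0. eval f (m # xs) y)
      \<Longrightarrow> eval (Mini f) xs n"

definition computable1 :: "(nat \<Rightarrow> nat) \<Rightarrow> bool" where
  "computable1 f \<longleftrightarrow> (\<exists>r. \<forall>x. eval r [x] (f x))"

definition computable2 :: "(nat \<Rightarrow> nat \<Rightarrow> nat) \<Rightarrow> bool" where
  "computable2 f \<longleftrightarrow> (\<exists>r. \<forall>x y. eval r [x, y] (f x y))"

definition computable3 :: "(nat \<Rightarrow> nat \<Rightarrow> nat \<Rightarrow> nat) \<Rightarrow> bool" where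
  "computable3 f \<longleftrightarrow> (\<exists>r. \<forall>x y z. eval r [x, y, z] (f x y z))"

definition ce_set :: "nat set \<Rightarrow> bool" where
  "ce_set A \<longleftrightarrow> (\<exists>r. \<forall>x. x \<in> A \<longleftrightarrow> (\<exists>y. eval r [x] y))"

definition computable_rat_seq :: "(nat \<Rightarrow> rat) \<Rightarrow> bool" where
  "computable_rat_seq q \<longleftrightarrow> (\<exists>a b c. computable1 a \<and> computable1 b \<and> computable1 c \<and>
     (\<forall>i. q i = (of_nat (a i) - of_nat (b i)) / (of_nat (c i) + 1)))"

definition computable_real2 :: "(nat \<Rightarrow> nat \<Rightarrow> real) \<Rightarrow> bool" where
  "computable_real2 g \<longleftrightarrow> (\<exists>a b c. computable3 a \<and> computable3 b \<and> computable3 c \<and>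
     (\<forall>x y i. \<bar>g x y - (real (a x y i) - real (b x y i)) / (real (c x y i) + 1)\<bar> < (1/2) ^ i))"

definition computable_metric_space :: "(nat \<Rightarrow> 'a::metric_space) \<Rightarrow> bool" where
  "computable_metric_space \<alpha> \<longleftrightarrow> closure (range \<alpha>) = UNIV \<and>
     computable_real2 (\<lambda>i j. dist (\<alpha> i) (\<alpha> j))"

definition admissible_numberings ::
  "(nat \<Rightarrow> rat) \<Rightarrow> (nat \<Rightarrow> nat) \<Rightarrow> (nat \<Rightarrow> nat) \<Rightarrow> (nat \<Rightarrow> nat \<Rightarrow> nat) \<Rightarrow> (nat \<Rightarrow> nat) \<Rightarrow> bool"
  where
  "admissible_numberings q \<tau>1 \<tau>2 \<sigma> \<eta> \<longleftrightarrow>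
     computable_rat_seq q \<and> range q = {r. r > 0} \<and>
     computable1 \<tau>1 \<and> computable1 \<tau>2 \<and> range (\<lambda>i. (\<tau>1 i, \<tau>2 i)) = UNIV \<and>
     computable2 \<sigma> \<and> computable1 \<eta> \<and>
     range (\<lambda>j. map (\<sigma> j) [0..<Suc (\<eta> j)]) = {l. l \<noteq> []}"

definition rball :: "(nat \<Rightarrow> 'a::metric_space) \<Rightarrow> (nat \<Rightarrow> rat) \<Rightarrow> (nat \<Rightarrow> nat) \<Rightarrow> (nat \<Rightarrow> nat)
    \<Rightarrow> nat \<Rightarrow> 'a set" where
  "rball \<alpha> q \<tau>1 \<tau>2 i = ball (\<alpha> (\<tau>1 i)) (real_of_rat (q (\<tau>2 i)))"

definition runion :: "(nat \<Rightarrow> 'a::metric_space) \<Rightarrow> (nat \<Rightarrow> rat) \<Rightarrow> (nat \<Rightarrow> nat) \<Rightarrow> (nat \<Rightarrow> nat)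
    \<Rightarrow> (nat \<Rightarrow> nat \<Rightarrow> nat) \<Rightarrow> (nat \<Rightarrow> nat) \<Rightarrow> nat \<Rightarrow> 'a set" where
  "runion \<alpha> q \<tau>1 \<tau>2 \<sigma> \<eta> j = (\<Union>i\<in>{\<sigma> j k | k. k \<le> \<eta> j}. rball \<alpha> q \<tau>1 \<tau>2 i)"

definition semicomputable_compact ::
  "(nat \<Rightarrow> 'a::metric_space) \<Rightarrow> (nat \<Rightarrow> rat) \<Rightarrow> (nat \<Rightarrow> nat) \<Rightarrow> (nat \<Rightarrow> nat)
    \<Rightarrow> (nat \<Rightarrow> nat \<Rightarrow> nat) \<Rightarrow> (nat \<Rightarrow> nat) \<Rightarrow> 'a set \<Rightarrow> bool" where
  "semicomputable_compact \<alpha> q \<tau>1 \<tau>2 \<sigma> \<eta> K \<longleftrightarrow>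
     compact K \<and> ce_set {j. K \<subseteq> runion \<alpha> q \<tau>1 \<tau>2 \<sigma> \<eta> j}"

definition computable_compact ::
  "(nat \<Rightarrow> 'a::metric_space) \<Rightarrow> (nat \<Rightarrow> rat) \<Rightarrow> (nat \<Rightarrow> nat) \<Rightarrow> (nat \<Rightarrow> nat)
    \<Rightarrow> (nat \<Rightarrow> nat \<Rightarrow> nat) \<Rightarrow> (nat \<Rightarrow> nat) \<Rightarrow> 'a set \<Rightarrow> bool" where
  "computable_compact \<alpha> q \<tau>1 \<tau>2 \<sigma> \<eta> K \<longleftrightarrow>
     semicomputable_compact \<alpha> q \<tau>1 \<tau>2 \<sigma> \<eta> K \<and>
     ce_set {i. K \<inter> rball \<alpha> q \<tau>1 \<tau>2 i \<noteq> {}}"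

definition manifold :: "'a topology \<Rightarrow> bool" where
  "manifold T \<longleftrightarrow> topspace T \<noteq> {} \<and>
     (\<exists>n\<ge>1. \<forall>x\<in>topspace T. \<exists>U N. openin T U \<and> x \<in> U \<and> U \<subseteq> N \<and> N \<subseteq> topspace T \<and>
        (subtopology T N) homeomorphic_space (Euclidean_space n))"

end

(*
Every point x of S has a neighbourhood V in S on which "I_i meets S" can be confirmed by a
recursively enumerable search, and finitely many such V cover S. In a chart around x take a cube D
and fix finitely many rational balls: those in W cover S outside a larger cube and miss D, while
P k and Q k cover the upper and the lower k-th face of D. The criterion for I_i asks for finite
families A k, B k of rational balls with A k formally disjoint from B k and P k, and B k formally
disjoint from Q k, such that W, I_i and all A k, B k together cover S. If I_i missed S, the A k and
B k would cover D, and by Kuhn's lemma a cube is never covered by such pairs of disjoint open sets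
separating opposite faces; so the criterion is sound. Conversely, if I_i contains a point z of V, the
coordinate sectors around z, cut off near z, are compact and pairwise disjoint, and fine covers of
them satisfy the criterion. As only finitely many points x are used, no uniformity in x is needed.
*)
theory Submission
  imports Defs
begin

text \<open>The hypothesis only lets finite covers of \<open>S\<close> be confirmed, while the goal
  is to confirm that a ball meets \<open>S\<close>. The criterion turns the second kind of statement
  into the first: the cover it asks for must use the tested ball somewhere on \<open>S\<close>,
  since the remaining balls alone cannot fill the cube.

  Disjointness of balls as sets need not be recognisable, so the inequality \<open>far\<close>
  between centres and radii replaces it: a strict inequality between computable reals shows itself
  at finite precision. Compactness leaves enough room for it in the converse direction.

  The families \<open>W\<close>, \<open>P\<close>, \<open>Q\<close> come from a noncomputable
  choice, but they are finite and independent of the tested index; only \<open>A\<close> and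
  \<open>B\<close> depend on it, and these are searched for. The given numbering
  \<open>\<sigma>\<close> codes both these families and the computation traces that make
  \<open>eval\<close> itself enumerable.\<close>

section \<open>Recursive functions of several arguments\<close>

definition recursive :: "nat \<Rightarrow> (nat list \<Rightarrow> nat) \<Rightarrow> bool" where
  "recursive n f \<longleftrightarrow> (\<exists>r. \<forall>xs. length xs = n \<longrightarrow> eval r xs (f xs))"

definition recursive_args :: "nat \<Rightarrow> nat \<Rightarrow> (nat list \<Rightarrow> nat list) \<Rightarrow> bool" where
  "recursive_args n m h \<longleftrightarrow> (\<forall>xs. length xs = n \<longrightarrow> length (h xs) = m) \<and>
     (\<forall>i<m. recursive n (\<lambda>xs. h xs ! i))"

inductive_cases eval_ZeroE: "eval Zero xs z"
inductive_cases eval_SuccE: "eval Succ xs z"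
inductive_cases eval_ProjE: "eval (Proj i) xs z"
inductive_cases eval_CompE: "eval (Comp f gs) xs z"
inductive_cases eval_Prim0E: "eval (Prim f g) (0 # xs) z"
inductive_cases eval_PrimSE: "eval (Prim f g) (Suc n # xs) z"
inductive_cases eval_PrimE: "eval (Prim f g) xs z"
inductive_cases eval_MiniE: "eval (Mini f) xs z"

text \<open>In the minimisation case the smaller of two results would give the body both the value 0
  and a positive value. Determinism is what lets a halting search be read back as a zero of a total
  function.\<close>

lemma eval_deterministic: "eval r xs y \<Longrightarrow> eval r xs z \<Longrightarrow> y = z"
proof (induction arbitrary: z rule: eval.induct)
  case (eval_Comp ys gs xs f y)
  from eval_Comp.prems obtain ys' where ys': "length ys' = length gs"
    "\<forall>i<length gs. eval (gs ! i) xs (ys' ! i)" "eval f ys' z"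
    by (rule eval_CompE) blast
  have "ys = ys'"
    using eval_Comp.hyps(1) eval_Comp.IH(1) ys' by (intro nth_equalityI) auto
  then show ?case using eval_Comp.IH(2) ys' by blast
next
  case (eval_Mini f n xs)
  from eval_Mini.prems have z: "eval f (z # xs) 0" "\<forall>m<z. \<exists>y>0. eval f (m # xs) y"
    by (auto elim: eval_MiniE)
  show ?case
  proof (rule linorder_cases[of n z])
    assume "n < z"
    then obtain y where "y > 0" "eval f (n # xs) y" using z by blast
    then show ?thesis using eval_Mini.IH(1) by fastforce
  next
    assume "z < n"
    then show ?thesis using eval_Mini.IH(2) z by fastforce
  qed
next
  case (eval_Prim0 f xs z g)
  then show ?case by (blast elim: eval_Prim0E)
next
  case (eval_PrimS f g n xs y z)
  then show ?case by (blast elim: eval_PrimSE)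
qed (auto elim: eval_ZeroE eval_SuccE eval_ProjE)

lemma recursive_cong:
  assumes "recursive n f" "\<And>xs. length xs = n \<Longrightarrow> f xs = g xs"
  shows "recursive n g"
  using assms unfolding recursive_def by metis

lemma recursive_subst:
  assumes f: "recursive m f" and h: "recursive_args n m h"
  shows "recursive n (\<lambda>xs. f (h xs))"
proof -
  obtain r where r: "\<And>xs. length xs = m \<Longrightarrow> eval r xs (f xs)"
    using f by (auto simp: recursive_def)
  have "\<forall>i. \<exists>s. i < m \<longrightarrow> (\<forall>xs. length xs = n \<longrightarrow> eval s xs (h xs ! i))"
    using h by (auto simp: recursive_args_def recursive_def)
  then obtain s where s: "\<And>i xs. i < m \<Longrightarrow> length xs = n \<Longrightarrow> eval (s i) xs (h xs ! i)"
    by metis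
  have "eval (Comp r (map s [0..<m])) xs (f (h xs))" if "length xs = n" for xs
    using that h by (intro eval_Comp[of "h xs"] r) (auto simp: recursive_args_def s)
  then show ?thesis by (auto simp: recursive_def)
qed

lemma recursive_nth: "i < n \<Longrightarrow> recursive n (\<lambda>xs. xs ! i)"
  by (auto simp: recursive_def intro!: exI[of _ "Proj i"] eval_Proj)

lemma recursive_args_Nil: "recursive_args n 0 (\<lambda>xs. [])"
  by (simp add: recursive_args_def)

lemma recursive_args_Cons:
  "recursive n f \<Longrightarrow> recursive_args n m h \<Longrightarrow> recursive_args n (Suc m) (\<lambda>xs. f xs # h xs)"
  by (auto simp: recursive_args_def less_Suc_eq_0_disj)

lemma recursive_args_id: "recursive_args n n (\<lambda>xs. xs)"
  by (simp add: recursive_args_def recursive_nth)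

lemma recursive_args_tl: "recursive_args (Suc n) n (\<lambda>xs. tl xs)"
  unfolding recursive_args_def
  by (auto simp: nth_tl intro!: recursive_cong[OF recursive_nth[of "Suc _" "Suc n"]])

lemma recursive_lift: "recursive n f \<Longrightarrow> recursive (Suc n) (\<lambda>xs. f (tl xs))"
  by (rule recursive_subst[OF _ recursive_args_tl])

lemma recursive_args_lift: "recursive_args n m h \<Longrightarrow> recursive_args (Suc n) m (\<lambda>xs. h (tl xs))"
  using recursive_lift by (auto simp: recursive_args_def)

lemma recursive_hd: "recursive (Suc n) (\<lambda>xs. hd xs)"
  by (rule recursive_cong[OF recursive_nth[of 0]]) (auto simp: length_Suc_conv)

text \<open>Binders push their variable onto the front of the argument list, so variables are de
  Bruijn indices, written as \<open>hd\<close> after some number of \<open>tl\<close>.\<close>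

lemmas recursive_vars = recursive_hd recursive_hd[THEN recursive_lift]
  recursive_hd[THEN recursive_lift, THEN recursive_lift]
  recursive_hd[THEN recursive_lift, THEN recursive_lift, THEN recursive_lift]
  recursive_hd[THEN recursive_lift, THEN recursive_lift, THEN recursive_lift, THEN recursive_lift]
  recursive_hd[THEN recursive_lift, THEN recursive_lift, THEN recursive_lift, THEN recursive_lift,
    THEN recursive_lift]
lemmas recursive_args_intros = recursive_args_Nil recursive_args_Cons recursive_args_id
  recursive_args_id[THEN recursive_args_lift]
  recursive_args_id[THEN recursive_args_lift, THEN recursive_args_lift]
  recursive_args_id[THEN recursive_args_lift, THEN recursive_args_lift, THEN recursive_args_lift]
  recursive_args_id[THEN recursive_args_lift, THEN recursive_args_lift, THEN recursive_args_lift,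
    THEN recursive_args_lift]

lemma recursive_comp1:
  assumes "computable1 f" "recursive n g" shows "recursive n (\<lambda>xs. f (g xs))"
proof -
  have "recursive (Suc 0) (\<lambda>xs. f (hd xs))"
    using assms(1) unfolding computable1_def recursive_def
    by (elim ex_forward) (auto simp: length_Suc_conv)
  then have "recursive n (\<lambda>xs. (\<lambda>xs. f (hd xs)) [g xs])"
    by (rule recursive_subst) (intro recursive_args_intros assms)
  then show ?thesis by simp
qed

lemma recursive_comp2:
  assumes "computable2 f" "recursive n g" "recursive n h"
  shows "recursive n (\<lambda>xs. f (g xs) (h xs))"
proof -
  have "recursive (Suc (Suc 0)) (\<lambda>xs. f (hd xs) (hd (tl xs)))"
    using assms(1) unfolding computable2_def recursive_def
    by (elim ex_forward) (auto simp: length_Suc_conv)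
  then have "recursive n (\<lambda>xs. (\<lambda>xs. f (hd xs) (hd (tl xs))) [g xs, h xs])"
    by (rule recursive_subst) (intro recursive_args_intros assms)
  then show ?thesis by simp
qed

lemma recursive_comp3:
  assumes "computable3 f" "recursive n g" "recursive n h" "recursive n k"
  shows "recursive n (\<lambda>xs. f (g xs) (h xs) (k xs))"
proof -
  have "recursive (Suc (Suc (Suc 0))) (\<lambda>xs. f (hd xs) (hd (tl xs)) (hd (tl (tl xs))))"
    using assms(1) unfolding computable3_def recursive_def
    by (elim ex_forward) (auto simp: length_Suc_conv)
  then have "recursive n (\<lambda>xs. (\<lambda>xs. f (hd xs) (hd (tl xs)) (hd (tl (tl xs)))) [g xs, h xs, k xs])"
    by (rule recursive_subst) (intro recursive_args_intros assms)
  then show ?thesis by simp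
qed

lemma recursive_Prim:
  assumes "recursive n f" "recursive (Suc (Suc n)) g"
  shows "recursive (Suc n) (\<lambda>xs. rec_nat (f (tl xs)) (\<lambda>k y. g (y # k # tl xs)) (hd xs))"
proof -
  obtain r s where r: "\<And>xs. length xs = n \<Longrightarrow> eval r xs (f xs)"
    and s: "\<And>xs. length xs = Suc (Suc n) \<Longrightarrow> eval s xs (g xs)"
    using assms by (auto simp: recursive_def)
  have *: "eval (Prim r s) (m # xs) (rec_nat (f xs) (\<lambda>k y. g (y # k # xs)) m)"
    if "length xs = n" for m xs
    by (induction m) (use that in \<open>auto intro!: eval_Prim0 r s intro: eval_PrimS\<close>)
  show ?thesis
    unfolding recursive_def by (rule exI[of _ "Prim r s"]) (auto simp: length_Suc_conv *)
qed

lemma recursive_Suc: "recursive n f \<Longrightarrow> recursive n (\<lambda>xs. Suc (f xs))"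
  by (rule recursive_comp1) (auto simp: computable1_def intro!: exI[of _ Succ] eval_Succ)

lemma recursive_zero: "recursive n (\<lambda>xs. 0)"
  by (auto simp: recursive_def intro!: exI[of _ Zero] eval_Zero)

lemma recursive_const: "recursive n (\<lambda>xs. c)"
  by (induction c) (auto intro: recursive_zero recursive_Suc)

lemma recursive_rec_nat:
  assumes "recursive n b" "recursive n f" "recursive (Suc (Suc n)) (\<lambda>xs. g (hd (tl xs)) (hd xs) (tl (tl xs)))"
  shows "recursive n (\<lambda>xs. rec_nat (f xs) (\<lambda>k y. g k y xs) (b xs))"
proof -
  note recursive_Prim[OF assms(2,3)]
  from recursive_subst[OF this, of n "\<lambda>xs. b xs # xs"] show ?thesis
    by (simp add: recursive_args_intros assms)
qed

lemma recursive_add: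
  assumes "recursive n f" "recursive n g" shows "recursive n (\<lambda>xs. f xs + g xs)"
proof -
  have "recursive n (\<lambda>xs. rec_nat (f xs) (\<lambda>k y. Suc y) (g xs))"
    by (intro recursive_rec_nat assms recursive_Suc recursive_vars)
  moreover have "rec_nat a (\<lambda>k y. Suc y) b = a + b" for a b by (induction b) auto
  ultimately show ?thesis by simp
qed

lemma recursive_mult:
  assumes "recursive n f" "recursive n g" shows "recursive n (\<lambda>xs. f xs * g xs)"
proof -
  have "recursive n (\<lambda>xs. rec_nat 0 (\<lambda>k y. y + f xs) (g xs))"
    by (intro recursive_rec_nat assms recursive_add recursive_vars recursive_zero
        recursive_lift[OF recursive_lift[OF assms(1)]])
  moreover have "rec_nat 0 (\<lambda>k y. y + a) b = a * b" for a b :: nat by (induction b) auto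
  ultimately show ?thesis by simp
qed

lemma recursive_pred:
  assumes "recursive n f" shows "recursive n (\<lambda>xs. f xs - 1)"
proof -
  have "recursive n (\<lambda>xs. rec_nat 0 (\<lambda>k y. k) (f xs))"
    by (intro recursive_rec_nat assms recursive_vars recursive_zero)
  moreover have "rec_nat 0 (\<lambda>k y. k) b = b - 1" for b :: nat by (cases b) auto
  ultimately show ?thesis by simp
qed

lemma recursive_diff:
  assumes "recursive n f" "recursive n g" shows "recursive n (\<lambda>xs. f xs - g xs)"
proof -
  have "recursive n (\<lambda>xs. rec_nat (f xs) (\<lambda>k y. y - 1) (g xs))"
    by (intro recursive_rec_nat assms recursive_vars recursive_pred)
  moreover have "rec_nat a (\<lambda>k y. y - 1) b = a - b" for a b :: nat by (induction b) auto
  ultimately show ?thesis by simp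
qed

lemma recursive_sum:
  assumes "recursive n b" "recursive (Suc n) (\<lambda>xs. f (hd xs) (tl xs))"
  shows "recursive n (\<lambda>xs. \<Sum>k<b xs. f k xs)"
proof -
  have "recursive (Suc (Suc n)) (\<lambda>xs. (\<lambda>xs. f (hd xs) (tl xs)) (tl xs))"
    by (intro recursive_lift assms)
  then have "recursive n (\<lambda>xs. rec_nat 0 (\<lambda>k y. y + f k xs) (b xs))"
    by (intro recursive_rec_nat assms recursive_add recursive_vars recursive_zero)
  moreover have "rec_nat 0 (\<lambda>k y. y + g k) m = (\<Sum>k<m. g k)" for g :: "nat \<Rightarrow> nat" and m by (induction m) auto
  ultimately show ?thesis by simp
qed

lemma recursive_prod:
  assumes "recursive n b" "recursive (Suc n) (\<lambda>xs. f (hd xs) (tl xs))"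
  shows "recursive n (\<lambda>xs. \<Prod>k<b xs. f k xs)"
proof -
  have "recursive (Suc (Suc n)) (\<lambda>xs. (\<lambda>xs. f (hd xs) (tl xs)) (tl xs))"
    by (intro recursive_lift assms)
  then have "recursive n (\<lambda>xs. rec_nat 1 (\<lambda>k y. y * f k xs) (b xs))"
    by (intro recursive_rec_nat assms recursive_mult recursive_vars recursive_const)
  moreover have "rec_nat 1 (\<lambda>k y. y * g k) m = (\<Prod>k<m. g k)" for g :: "nat \<Rightarrow> nat" and m by (induction m) auto
  ultimately show ?thesis by simp
qed

lemma recursive_power:
  assumes "recursive n f" shows "recursive n (\<lambda>xs. 2 ^ f xs)"
proof -
  have "recursive n (\<lambda>xs. \<Prod>k<f xs. 2)" by (intro recursive_prod assms recursive_const)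
  then show ?thesis by simp
qed

section \<open>Recursively enumerable predicates\<close>

text \<open>A search for a zero of a total function: every stage terminates, so searches combine by
  sums and products. Partial codes are linked to this form by \<open>re_eval\<close> and
  \<open>ce_set_if_re\<close>.\<close>

definition re :: "nat \<Rightarrow> (nat list \<Rightarrow> bool) \<Rightarrow> bool" where
  "re n P \<longleftrightarrow> (\<exists>f. recursive (Suc n) f \<and>
     (\<forall>xs. length xs = n \<longrightarrow> (P xs \<longleftrightarrow> (\<exists>t. f (t # xs) = 0))))"

lemma re_cong:
  assumes "re n P" "\<And>xs. length xs = n \<Longrightarrow> P xs = Q xs" shows "re n Q"
  using assms unfolding re_def by auto

lemma re_subst:
  assumes "re m P" "recursive_args n m h" shows "re n (\<lambda>xs. P (h xs))"
proof -
  obtain f where f: "recursive (Suc m) f"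
    "\<And>xs. length xs = m \<Longrightarrow> P xs \<longleftrightarrow> (\<exists>t. f (t # xs) = 0)"
    using assms(1) by (auto simp: re_def)
  have "recursive (Suc n) (\<lambda>xs. f (hd xs # h (tl xs)))"
    by (intro recursive_subst[OF f(1)] recursive_args_intros recursive_vars
        recursive_args_lift assms)
  then show ?thesis
    using assms(2) unfolding re_def recursive_args_def
    by (intro exI[of _ "\<lambda>xs. f (hd xs # h (tl xs))"]) (auto simp: f)
qed

text \<open>Multiplying the values of all stages up to \<open>t\<close> keeps a zero once it has
  appeared, so that several searches can be inspected at one common stage.\<close>

lemma re_monotoneE:
  assumes "re n P"
  obtains f where "recursive (Suc n) f"
    "\<And>xs. length xs = n \<Longrightarrow> P xs \<longleftrightarrow> (\<exists>t. f (t # xs) = 0)"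
    "\<And>xs s t. s \<le> t \<Longrightarrow> f (s # xs) = 0 \<Longrightarrow> f (t # xs) = 0"
proof -
  obtain f where f: "recursive (Suc n) f"
    "\<And>xs. length xs = n \<Longrightarrow> P xs \<longleftrightarrow> (\<exists>t. f (t # xs) = 0)"
    using assms by (auto simp: re_def)
  show thesis
  proof (rule that)
    show "recursive (Suc n) (\<lambda>ys. \<Prod>k<Suc (hd ys). f (k # tl ys))"
      by (intro recursive_prod recursive_Suc recursive_vars recursive_subst[OF f(1)]
          recursive_args_intros)
    show "P xs \<longleftrightarrow> (\<exists>t. (\<Prod>k<Suc (hd (t # xs)). f (k # tl (t # xs))) = 0)"
      if "length xs = n" for xs
      using f(2)[OF that] by (auto simp: less_Suc_eq_le intro: exI[of _ "_::nat"])
    show "(\<Prod>k<Suc (hd (t # xs)). f (k # tl (t # xs))) = 0"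
      if "s \<le> t" "(\<Prod>k<Suc (hd (s # xs)). f (k # tl (s # xs))) = 0" for xs s t
      using that by (auto simp: less_Suc_eq_le simp del: prod.lessThan_Suc intro: order_trans)
  qed
qed

lemma re_conj:
  assumes "re n P" "re n Q" shows "re n (\<lambda>xs. P xs \<and> Q xs)"
proof -
  obtain f where f: "recursive (Suc n) f"
    "\<And>xs. length xs = n \<Longrightarrow> P xs \<longleftrightarrow> (\<exists>t. f (t # xs) = 0)"
    "\<And>xs s t. s \<le> t \<Longrightarrow> f (s # xs) = 0 \<Longrightarrow> f (t # xs) = 0"
    using re_monotoneE[OF assms(1)] by blast
  obtain g where g: "recursive (Suc n) g"
    "\<And>xs. length xs = n \<Longrightarrow> Q xs \<longleftrightarrow> (\<exists>t. g (t # xs) = 0)"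
    "\<And>xs s t. s \<le> t \<Longrightarrow> g (s # xs) = 0 \<Longrightarrow> g (t # xs) = 0"
    using re_monotoneE[OF assms(2)] by blast
  have "(P xs \<and> Q xs) \<longleftrightarrow> (\<exists>t. f (t # xs) + g (t # xs) = 0)"
    if xs: "length xs = n" for xs
  proof
    assume "P xs \<and> Q xs"
    then obtain s t where "f (s # xs) = 0" "g (t # xs) = 0"
      using f(2)[OF xs] g(2)[OF xs] by blast
    then have "f (max s t # xs) = 0" "g (max s t # xs) = 0"
      using f(3)[of s "max s t"] g(3)[of t "max s t"] by auto
    then show "\<exists>t. f (t # xs) + g (t # xs) = 0" by auto
  qed (use f(2) g(2) xs in auto)
  then show ?thesis
    unfolding re_def using recursive_add[OF f(1) g(1)] by blast
qed

lemma re_disj: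
  assumes "re n P" "re n Q" shows "re n (\<lambda>xs. P xs \<or> Q xs)"
proof -
  obtain f where f: "recursive (Suc n) f"
    "\<And>xs. length xs = n \<Longrightarrow> P xs \<longleftrightarrow> (\<exists>t. f (t # xs) = 0)"
    using assms(1) by (auto simp: re_def)
  obtain g where g: "recursive (Suc n) g"
    "\<And>xs. length xs = n \<Longrightarrow> Q xs \<longleftrightarrow> (\<exists>t. g (t # xs) = 0)"
    using assms(2) by (auto simp: re_def)
  have "(P xs \<or> Q xs) \<longleftrightarrow> (\<exists>t. f (t # xs) * g (t # xs) = 0)" if "length xs = n" for xs
    using f(2) g(2) that by auto
  then show ?thesis
    unfolding re_def using recursive_mult[OF f(1) g(1)] by blast
qed

text \<open>One number \<open>t\<close> bounds both the witness \<open>k\<close> and the stage of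
  its search, which spares a pairing function.\<close>

lemma re_ex:
  assumes "re (Suc n) (\<lambda>xs. Q (hd xs) (tl xs))"
  shows "re n (\<lambda>xs. \<exists>k. Q k xs)"
proof -
  obtain f where f: "recursive (Suc (Suc n)) f"
    "\<And>xs. length xs = Suc n \<Longrightarrow> Q (hd xs) (tl xs) \<longleftrightarrow> (\<exists>t. f (t # xs) = 0)"
    "\<And>xs s t. s \<le> t \<Longrightarrow> f (s # xs) = 0 \<Longrightarrow> f (t # xs) = 0"
    using re_monotoneE[OF assms] by blast
  define F where "F = (\<lambda>ys. \<Prod>k<Suc (hd ys). f (hd ys # k # tl ys))"
  have "recursive (Suc n) F"
    unfolding F_def
    by (intro recursive_prod recursive_Suc recursive_vars recursive_subst[OF f(1)]
        recursive_args_intros)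
  moreover have "(\<exists>k. Q k xs) \<longleftrightarrow> (\<exists>t. F (t # xs) = 0)" if xs: "length xs = n" for xs
  proof
    assume "\<exists>k. Q k xs"
    then obtain k where "Q k xs" by blast
    then obtain t where "f (t # k # xs) = 0" using f(2)[of "k # xs"] xs by auto
    then have "f (max k t # k # xs) = 0" by (rule f(3)[rotated]) simp
    then have "F (max k t # xs) = 0"
      unfolding F_def by (auto simp: less_Suc_eq_le simp del: prod.lessThan_Suc intro!: bexI[of _ k])
    then show "\<exists>t. F (t # xs) = 0" by blast
  next
    assume "\<exists>t. F (t # xs) = 0"
    then obtain t k where "f (t # k # xs) = 0"
      unfolding F_def by (auto simp: less_Suc_eq_le simp del: prod.lessThan_Suc)
    then show "\<exists>k. Q k xs" using f(2)[of "k # xs"] xs by auto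
  qed
  ultimately show ?thesis unfolding re_def by blast
qed

text \<open>Bounded quantification stays recursively enumerable because finitely many witnesses have
  a common upper bound.\<close>

lemma re_all_below:
  assumes "recursive n b" "re (Suc n) (\<lambda>xs. Q (hd xs) (tl xs))"
  shows "re n (\<lambda>xs. \<forall>k<b xs. Q k xs)"
proof -
  obtain f where f: "recursive (Suc (Suc n)) f"
    "\<And>xs. length xs = Suc n \<Longrightarrow> Q (hd xs) (tl xs) \<longleftrightarrow> (\<exists>t. f (t # xs) = 0)"
    "\<And>xs s t. s \<le> t \<Longrightarrow> f (s # xs) = 0 \<Longrightarrow> f (t # xs) = 0"
    using re_monotoneE[OF assms(2)] by blast
  define F where "F = (\<lambda>ys. \<Sum>k<b (tl ys). f (hd ys # k # tl ys))"
  have "recursive (Suc n) F"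
    unfolding F_def
    by (intro recursive_sum recursive_lift assms recursive_vars recursive_subst[OF f(1)]
        recursive_args_intros)
  moreover have "(\<forall>k<b xs. Q k xs) \<longleftrightarrow> (\<exists>t. F (t # xs) = 0)" if xs: "length xs = n" for xs
  proof
    assume "\<forall>k<b xs. Q k xs"
    then have "\<forall>k. \<exists>t. k < b xs \<longrightarrow> f (t # k # xs) = 0" using f(2)[of "_ # xs"] xs by auto
    then obtain t where t: "\<And>k. k < b xs \<Longrightarrow> f (t k # k # xs) = 0" by metis
    have "f ((\<Sum>j<b xs. t j) # k # xs) = 0" if "k < b xs" for k
      by (rule f(3)[OF _ t[OF that]]) (use that in \<open>auto intro: member_le_sum\<close>)
    then have "F ((\<Sum>j<b xs. t j) # xs) = 0" unfolding F_def by auto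
    then show "\<exists>t. F (t # xs) = 0" by blast
  next
    assume "\<exists>t. F (t # xs) = 0"
    then show "\<forall>k<b xs. Q k xs"
      unfolding F_def using f(2)[of "_ # xs"] xs by auto
  qed
  ultimately show ?thesis unfolding re_def by blast
qed

lemma re_eq_zero: "recursive n f \<Longrightarrow> re n (\<lambda>xs. f xs = 0)"
  unfolding re_def by (intro exI[of _ "\<lambda>xs. f (tl xs)"]) (auto intro: recursive_lift)

lemma re_le:
  assumes "recursive n f" "recursive n g" shows "re n (\<lambda>xs. f xs \<le> g xs)"
  using re_eq_zero[OF recursive_diff[OF assms]] by simp

lemma re_less:
  assumes "recursive n f" "recursive n g" shows "re n (\<lambda>xs. f xs < g xs)"
  using re_le[OF recursive_Suc[OF assms(1)] assms(2)] by (simp add: Suc_le_eq)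

lemma re_eq:
  assumes "recursive n f" "recursive n g" shows "re n (\<lambda>xs. f xs = g xs)"
  using re_conj[OF re_le[OF assms] re_le[OF assms(2,1)]] by (simp add: order_eq_iff)

lemma re_const: "re n (\<lambda>xs. b)"
  by (cases b) (use re_eq_zero[OF recursive_const[of n 0]] re_eq_zero[OF recursive_const[of n 1]] in auto)

text \<open>The predicates \<open>P a\<close> may depend on \<open>a\<close> in any way whatever:
  finitely many search procedures are merged one at a time.\<close>

lemma re_bex_finite:
  assumes "finite A" "\<And>a. a \<in> A \<Longrightarrow> re n (P a)" shows "re n (\<lambda>xs. \<exists>a\<in>A. P a xs)"
  using assms by (induction A rule: finite_induct) (auto intro: re_const re_disj)

lemma re_all_less:
  fixes m :: nat
  assumes "\<And>i. i < m \<Longrightarrow> re n (P i)" shows "re n (\<lambda>xs. \<forall>i<m. P i xs)"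
  using assms by (induction m) (auto simp: All_less_Suc intro: re_const re_conj)

lemma re_eval_subst:
  assumes "re (Suc n) (\<lambda>xs. eval r (tl xs) (hd xs))" "recursive m z" "recursive_args m n h"
  shows "re m (\<lambda>xs. eval r (h xs) (z xs))"
  using re_subst[OF assms(1) recursive_args_Cons[OF assms(2,3)]] by simp

section \<open>Enumerability of the evaluation relation\<close>

context
  fixes \<sigma> :: "nat \<Rightarrow> nat \<Rightarrow> nat"
  assumes computable_\<sigma>: "computable2 \<sigma>"
    and surj_\<sigma>: "\<And>l. \<exists>c. map (\<sigma> c) [0..<length l] = l"
begin

text \<open>The list of intermediate values becomes one number \<open>c\<close>, so that a search
  over numbers finds it.\<close>

lemma eval_Comp_iff:
  "eval (Comp f gs) xs z \<longleftrightarrow> (\<exists>c. (\<forall>i<length gs. eval (gs ! i) xs (\<sigma> c i)) \<and>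
     eval f (map (\<sigma> c) [0..<length gs]) z)" (is "_ \<longleftrightarrow> ?R")
proof
  assume "eval (Comp f gs) xs z"
  then obtain ys where ys: "length ys = length gs"
    "\<forall>i<length gs. eval (gs ! i) xs (ys ! i)" "eval f ys z"
    by (rule eval_CompE) blast
  obtain c where c: "map (\<sigma> c) [0..<length ys] = ys" using surj_\<sigma> by blast
  then have "\<sigma> c i = ys ! i" if "i < length ys" for i
    using that by (metis add_0 length_map length_upt minus_nat.diff_0 nth_map_upt)
  then show ?R using c ys by (intro exI[of _ c]) auto
qed (auto intro!: eval_Comp[of "map (\<sigma> _) [0..<length gs]"])

text \<open>The trace of all values up to \<open>n\<close>, coded by \<open>c\<close>, replaces the
  recursion by local conditions under a bounded quantifier.\<close>

lemma eval_Prim_iff: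
  "eval (Prim f g) (n # xs) z \<longleftrightarrow> (\<exists>c. eval f xs (\<sigma> c 0) \<and>
     (\<forall>k<n. eval g (\<sigma> c k # k # xs) (\<sigma> c (Suc k))) \<and> \<sigma> c n = z)" (is "_ \<longleftrightarrow> ?R n z")
proof
  have "eval (Prim f g) (n # xs) z \<Longrightarrow> \<exists>s. eval f xs (s 0) \<and>
     (\<forall>k<n. eval g (s k # k # xs) (s (Suc k))) \<and> s n = z"
  proof (induction n arbitrary: z)
    case 0
    then show ?case by (auto elim: eval_Prim0E intro!: exI[of _ "\<lambda>_. z"])
  next
    case (Suc n)
    from Suc.prems obtain y where y: "eval (Prim f g) (n # xs) y" "eval g (y # n # xs) z"
      by (auto elim: eval_PrimSE)
    from Suc.IH[OF y(1)] obtain s where s: "eval f xs (s 0)"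
      "\<forall>k<n. eval g (s k # k # xs) (s (Suc k))" "s n = y" by blast
    with y(2) show ?case by (intro exI[of _ "s(Suc n := z)"]) (auto simp: less_Suc_eq)
  qed
  moreover assume "eval (Prim f g) (n # xs) z"
  ultimately obtain s where s: "eval f xs (s 0)"
     "\<forall>k<n. eval g (s k # k # xs) (s (Suc k))" "s n = z" by blast
  obtain c where c: "map (\<sigma> c) [0..<length (map s [0..<Suc n])] = map s [0..<Suc n]"
    using surj_\<sigma> by blast
  then have "\<sigma> c k = s k" if "k \<le> n" for k
    using that by (simp add: less_Suc_eq_le del: upt_Suc)
  then show "?R n z" using s by (intro exI[of _ c]) auto
next
  assume "?R n z"
  then obtain c where c: "eval f xs (\<sigma> c 0)"
     "\<forall>k<n. eval g (\<sigma> c k # k # xs) (\<sigma> c (Suc k))" "\<sigma> c n = z" by blast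
  have "eval (Prim f g) (k # xs) (\<sigma> c k)" if "k \<le> n" for k
    using that by (induction k) (auto intro: eval_Prim0 c(1) eval_PrimS simp: c(2))
  then show "eval (Prim f g) (n # xs) z" using c(3) by blast
qed

text \<open>Induction on the code makes its graph enumerable without a universal machine:
  \<open>r\<close> is fixed, and only the arguments \<open>tl xs\<close> and the candidate value
  \<open>hd xs\<close> vary. The arity is generalised because composition and recursion change
  it.\<close>

lemma re_eval: "re (Suc n) (\<lambda>xs. eval r (tl xs) (hd xs))"
proof (induction r arbitrary: n)
  case Zero
  have "re (Suc n) (\<lambda>xs. hd xs = 0)" by (intro re_eq_zero recursive_vars)
  then show ?case by (rule re_cong) (auto elim: eval_ZeroE intro: eval_Zero)
next
  case Succ
  show ?case
  proof (cases n)
    case 0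
    \<comment> \<open>\<open>Succ\<close> has no value on the empty list, so its graph is empty in
      arity 0.\<close>
    have "re (Suc n) (\<lambda>xs. False)" by (rule re_const)
    then show ?thesis by (rule re_cong) (auto elim: eval_SuccE simp: 0 length_Suc_conv)
  next
    case (Suc m)
    have "re (Suc n) (\<lambda>xs. hd xs = Suc (hd (tl xs)))"
      unfolding Suc by (intro re_eq recursive_vars recursive_Suc)
    then show ?thesis
      by (rule re_cong) (auto elim: eval_SuccE intro: eval_Succ simp: Suc length_Suc_conv)
  qed
next
  case (Proj i)
  show ?case
  proof (cases "i < n")
    case False
    have "re (Suc n) (\<lambda>xs. False)" by (rule re_const)
    then show ?thesis by (rule re_cong) (use False in \<open>auto elim: eval_ProjE\<close>)
  next
    case True
    have "re (Suc n) (\<lambda>xs. hd xs = tl xs ! i)"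
      by (intro re_eq recursive_vars recursive_lift[OF recursive_nth[OF True]])
    moreover have "hd xs = tl xs ! i \<longleftrightarrow> eval (Proj i) (tl xs) (hd xs)" if "length xs = Suc n" for xs
      using eval_Proj[of i "tl xs"] that True by (auto elim: eval_ProjE)
    ultimately show ?thesis by (rule re_cong)
  qed
next
  case (Comp f gs)
  have "recursive_args (Suc (Suc n)) (length gs) (\<lambda>xs. map (\<sigma> (hd xs)) [0..<length gs])"
    unfolding recursive_args_def
    by (simp add: recursive_comp2[OF computable_\<sigma> recursive_hd recursive_const])
  then have f: "re (Suc (Suc n)) (\<lambda>xs. eval f (map (\<sigma> (hd xs)) [0..<length gs]) (hd (tl xs)))"
    by (intro re_eval_subst[OF Comp.IH(1)[of "length gs"]] recursive_vars)
  have "re (Suc (Suc n)) (\<lambda>xs. eval (gs ! i) (tl (tl xs)) (\<sigma> (hd xs) i))" if "i < length gs" for i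
    by (intro re_eval_subst[OF Comp.IH(2)[OF nth_mem[OF that], of n]] recursive_vars recursive_args_intros
        recursive_comp2[OF computable_\<sigma>] recursive_const)
  then show ?case
    unfolding eval_Comp_iff by (intro re_ex re_conj re_all_less f)
next
  case (Prim f g)
  show ?case
  proof (cases n)
    case 0
    have "re (Suc n) (\<lambda>xs. False)" by (rule re_const)
    then show ?thesis by (rule re_cong) (auto elim: eval_PrimE simp: 0 length_Suc_conv)
  next
    case (Suc m)
    have "re (Suc n) (\<lambda>xs. \<exists>c. eval f (tl (tl xs)) (\<sigma> c 0) \<and>
        (\<forall>k<hd (tl xs). eval g (\<sigma> c k # k # tl (tl xs)) (\<sigma> c (Suc k))) \<and> \<sigma> c (hd (tl xs)) = hd xs)"
      unfolding Suc
      by (intro re_ex re_conj re_all_below re_eq re_eval_subst[OF Prim.IH(1)[of m]]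
          re_eval_subst[OF Prim.IH(2)[of "Suc (Suc m)"]]
        recursive_vars recursive_args_intros recursive_comp2[OF computable_\<sigma>] recursive_const recursive_Suc)
    then show ?thesis
      by (rule re_cong) (auto simp: Suc length_Suc_conv eval_Prim_iff)
  qed
next
  case (Mini f)
  \<comment> \<open>The values before the minimum have to exist and be positive, so an unbounded
    search stands under a bounded universal quantifier.\<close>
  have "re (Suc n) (\<lambda>xs. eval f (hd xs # tl xs) 0 \<and> (\<forall>m<hd xs. \<exists>y. 0 < y \<and> eval f (m # tl xs) y))"
    by (intro re_ex re_conj re_all_below re_less re_eval_subst[OF Mini.IH[of "Suc n"]]
        recursive_vars recursive_args_intros recursive_const)
  then show ?case
    by (rule re_cong) (auto elim: eval_MiniE intro!: eval_Mini)
qed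

lemma re_ce_set:
  assumes "ce_set A" "recursive n f" shows "re n (\<lambda>xs. f xs \<in> A)"
proof -
  obtain r where r: "\<And>x. x \<in> A \<longleftrightarrow> (\<exists>y. eval r [x] y)" using assms(1) by (auto simp: ce_set_def)
  show ?thesis
    unfolding r by (intro re_ex re_eval_subst[OF re_eval[of "Suc 0"]] recursive_args_intros
        recursive_vars recursive_lift assms(2))
qed

end

text \<open>\<open>Mini\<close> runs the search; as \<open>f\<close> is total, every value before
  the first zero exists and is positive.\<close>

lemma ce_set_if_re:
  assumes "re (Suc 0) (\<lambda>xs. hd xs \<in> A)" shows "ce_set A"
proof -
  obtain f where f: "recursive (Suc (Suc 0)) f" "\<And>x. x \<in> A \<longleftrightarrow> (\<exists>t. f [t, x] = 0)"
    using assms unfolding re_def by (metis length_Cons list.size(3) list.sel(1))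
  obtain r where r: "\<And>t x. eval r [t, x] (f [t, x])"
  proof -
    from f(1) obtain r where "\<forall>xs. length xs = Suc (Suc 0) \<longrightarrow> eval r xs (f xs)"
      unfolding recursive_def by blast
    then show thesis by (intro that[of r]) simp
  qed
  have "x \<in> A \<longleftrightarrow> (\<exists>y. eval (Mini r) [x] y)" for x
  proof
    assume "x \<in> A"
    then obtain t where "f [t, x] = 0" using f(2) by blast
    define m where "m = (LEAST t. f [t, x] = 0)"
    have "f [m, x] = 0" unfolding m_def by (rule LeastI) fact
    moreover have "f [k, x] > 0" if "k < m" for k
      using not_less_Least[of k "\<lambda>t. f [t, x] = 0"] that unfolding m_def by blast
    ultimately have "eval (Mini r) [x] m"
      using r[of m x] by (auto intro!: eval_Mini r exI[of _ "f [_, x]"])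
    then show "\<exists>y. eval (Mini r) [x] y" by blast
  next
    assume "\<exists>y. eval (Mini r) [x] y"
    then obtain y where "eval r [y, x] 0" by (auto elim: eval_MiniE)
    then have "f [y, x] = 0" using eval_deterministic[OF r] by blast
    then show "x \<in> A" using f(2) by blast
  qed
  then show ?thesis unfolding ce_set_def by blast
qed

section \<open>Cubes and Kuhn's lemma\<close>

text \<open>Points of n-dimensional space are functions vanishing from \<open>n\<close> on, as in
  \<open>Euclidean_space n\<close>, since the dimension is a number and not a type.\<close>

definition cube :: "nat \<Rightarrow> (nat \<Rightarrow> real) \<Rightarrow> real \<Rightarrow> (nat \<Rightarrow> real) set" where
  "cube n c s = {u. (\<forall>i<n. \<bar>u i - c i\<bar> \<le> s) \<and> (\<forall>i\<ge>n. u i = 0)}"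

lemma cube_mono: "s \<le> t \<Longrightarrow> cube n c s \<subseteq> cube n c t"
  by (auto simp: cube_def intro: order_trans)

text \<open>Tychonoff's theorem for intervals in the first \<open>n\<close> factors and
  \<open>{0}\<close> in all others.\<close>

lemma compact_cube: "compact (cube n c s)"
proof -
  have "cube n c s = PiE UNIV (\<lambda>i. if i < n then {c i - s..c i + s} else {0})"
    unfolding cube_def PiE_UNIV_domain Pi_def
    by (rule Collect_cong) (metis abs_diff_le_iff atLeastAtMost_iff iso_tuple_UNIV_I not_less singleton_iff)
  moreover have "compactin (product_topology (\<lambda>i. euclidean) UNIV)
      (PiE UNIV (\<lambda>i. if i < n then {c i - s..c i + s} else {0::real}))"
    by (subst compactin_PiE) auto
  ultimately show ?thesis by (simp add: euclidean_product_topology)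
qed

lemma tendsto_fun_iff:
  fixes y :: "'b \<Rightarrow> 'i \<Rightarrow> 'a::topological_space"
  shows "(y \<longlongrightarrow> u) F \<longleftrightarrow> (\<forall>i. ((\<lambda>m. y m i) \<longlongrightarrow> u i) F)"
  using limitin_componentwise[of "\<lambda>_. euclidean" UNIV y u F]
  by (simp add: euclidean_product_topology)

text \<open>If all cubes of radius \<open>1 / Suc m\<close> left \<open>U\<close>, points of them
  outside \<open>U\<close> would converge to \<open>z\<close> in every coordinate, hence in the
  product topology.\<close>

lemma cube_subset_open:
  fixes z :: "nat \<Rightarrow> real"
  assumes "open U" "z \<in> U" "\<forall>i\<ge>n. z i = 0"
  obtains s where "s > 0" "cube n z s \<subseteq> U"
proof -
  have "\<exists>m. cube n z (1 / Suc m) \<subseteq> U"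
  proof (rule ccontr)
    assume "\<nexists>m. cube n z (1 / Suc m) \<subseteq> U"
    then have "\<forall>m. \<exists>u. u \<in> cube n z (1 / Suc m) \<and> u \<notin> U" by blast
    then obtain y where y: "\<And>m. y m \<in> cube n z (1 / Suc m)" "\<And>m. y m \<notin> U" by metis
    have "(\<lambda>m. y m i) \<longlonglongrightarrow> z i" for i
    proof -
      have "\<bar>y m i - z i\<bar> \<le> 1 / Suc m" for m
        using y(1)[of m] assms(3) by (cases "i < n") (auto simp: cube_def)
      then have "(\<lambda>m. y m i - z i) \<longlonglongrightarrow> 0"
        by (intro Lim_null_comparison[OF _ LIMSEQ_inverse_real_of_nat]) (auto simp: inverse_eq_divide)
      then show ?thesis by (simp add: LIM_zero_iff)
    qed
    then have "y \<longlonglongrightarrow> z" by (simp add: tendsto_fun_iff)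
    then have "eventually (\<lambda>m. y m \<in> U) sequentially" using assms topological_tendstoD by blast
    with y(2) show False by simp
  qed
  then obtain m where "cube n z (1 / Suc m) \<subseteq> U" by blast
  then show thesis by (intro that[of "1 / Suc m"]) auto
qed

text \<open>On a grid of mesh \<open>2 * s / p\<close>, Kuhn's lemma yields one cell whose vertices
  take both labels in every coordinate \<open>k\<close>. Label 1 implies being outside
  \<open>A k\<close>, label 0 being outside \<open>B k\<close>, and the base vertex \<open>x\<close>
  of the cell is near all these vertices.\<close>

lemma kuhn_cube_step:
  fixes A :: "nat \<Rightarrow> (nat \<Rightarrow> real) set"
  assumes s: "s > 0" and p: "p > 0"
    and disj: "\<And>k. k < n \<Longrightarrow> A k \<inter> B k = {}"
    and upper: "\<And>k u. k < n \<Longrightarrow> u \<in> cube n c s \<Longrightarrow> u k = c k + s \<Longrightarrow> u \<notin> A k"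
    and lower: "\<And>k u. k < n \<Longrightarrow> u \<in> cube n c s \<Longrightarrow> u k = c k - s \<Longrightarrow> u \<notin> B k"
  obtains x where "x \<in> cube n c s"
    "\<And>k. k < n \<Longrightarrow> \<exists>y\<in>cube n c s. y \<notin> A k \<and> (\<forall>i. \<bar>y i - x i\<bar> \<le> 2 * s / real p)"
    "\<And>k. k < n \<Longrightarrow> \<exists>y\<in>cube n c s. y \<notin> B k \<and> (\<forall>i. \<bar>y i - x i\<bar> \<le> 2 * s / real p)"
proof -
  define pt where "pt = (\<lambda>a :: nat \<Rightarrow> nat. \<lambda>i. if i < n then c i - s + 2 * s * real (a i) / real p else 0)"
  \<comment> \<open>Kuhn's lemma wants label 0 on lower faces and label 1 on upper faces. The clause
    \<open>a i = 0\<close> forces the first; \<open>upper\<close> gives the second, because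
    \<open>p > 0\<close>.\<close>
  define label where "label = (\<lambda>a i. if pt a \<in> A i \<or> a i = 0 then 0 else 1::nat)"
  have pt_cube: "pt a \<in> cube n c s" if "\<forall>i<n. a i \<le> p" for a
  proof -
    have "\<bar>pt a i - c i\<bar> \<le> s" if "i < n" for i
    proof -
      have "0 \<le> 2 * s * real (a i) / real p" using s by simp
      moreover have "2 * s * real (a i) / real p \<le> 2 * s * 1"
        unfolding times_divide_eq_right[symmetric]
        using s p \<open>\<forall>i<n. a i \<le> p\<close> that by (intro mult_left_mono) auto
      ultimately show ?thesis using that by (simp add: pt_def abs_le_iff)
    qed
    then show ?thesis by (simp add: cube_def pt_def)
  qed
  obtain q where q: "\<forall>i<n. q i < p"
    and rs: "\<forall>i<n. \<exists>r t. (\<forall>j<n. q j \<le> r j \<and> r j \<le> q j + 1) \<and>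
      (\<forall>j<n. q j \<le> t j \<and> t j \<le> q j + 1) \<and> label r i \<noteq> label t i"
  proof (rule kuhn_lemma[of p n label])
    show "\<forall>x. (\<forall>i<n. x i \<le> p) \<longrightarrow> (\<forall>i<n. x i = p \<longrightarrow> label x i = 1)"
    proof (intro allI impI)
      fix x i assume x: "\<forall>i<n. x i \<le> p" "i < n" "x i = p"
      then have "pt x i = c i + s" using p by (simp add: pt_def)
      then show "label x i = 1" using upper[of i "pt x"] pt_cube x p by (simp add: label_def)
    qed
  qed (use p in \<open>auto simp: label_def\<close>)
  have *: "\<exists>r t. (\<forall>j<n. q j \<le> r j \<and> r j \<le> q j + 1) \<and>
      (\<forall>j<n. q j \<le> t j \<and> t j \<le> q j + 1) \<and> label r i = 0 \<and> label t i = 1" if i: "i < n" for i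
  proof -
    obtain r t where "\<forall>j<n. q j \<le> r j \<and> r j \<le> q j + 1"
      "\<forall>j<n. q j \<le> t j \<and> t j \<le> q j + 1" "label r i \<noteq> label t i" using rs i by blast
    moreover from this(3) have "label r i = 0 \<and> label t i = 1 \<or> label r i = 1 \<and> label t i = 0"
      by (auto simp: label_def split: if_splits)
    ultimately show ?thesis by blast
  qed
  have near: "pt r \<in> cube n c s \<and> (\<forall>i. \<bar>pt r i - pt q i\<bar> \<le> 2 * s / real p)"
    if r: "\<forall>j<n. q j \<le> r j \<and> r j \<le> q j + 1" for r
  proof (intro conjI allI pt_cube impI)
    fix i
    show "\<bar>pt r i - pt q i\<bar> \<le> 2 * s / real p"
    proof (cases "i < n")
      case True
      then have "pt r i - pt q i = 2 * s / real p * (real (r i) - real (q i))"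
        by (simp add: pt_def algebra_simps diff_divide_distrib)
      moreover have "\<bar>real (r i) - real (q i)\<bar> \<le> 1" using r True by force
      ultimately show ?thesis using s p
        by (simp add: abs_mult divide_right_mono mult_left_le)
    qed (use s in \<open>simp add: pt_def\<close>)
  next
    fix i assume "i < n"
    then have "r i \<le> q i + 1" "q i < p" using r q by auto
    then show "r i \<le> p" by linarith
  qed
  show thesis
  proof (rule that[of "pt q"])
    show "pt q \<in> cube n c s" using near[of q] by simp
    fix k assume k: "k < n"
    obtain r t where rt: "\<forall>j<n. q j \<le> r j \<and> r j \<le> q j + 1"
      "\<forall>j<n. q j \<le> t j \<and> t j \<le> q j + 1" "label r k = 0" "label t k = 1" using *[OF k] by blast
    have "pt t \<notin> A k" using rt(4) by (auto simp: label_def split: if_splits)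
    then show "\<exists>y\<in>cube n c s. y \<notin> A k \<and> (\<forall>i. \<bar>y i - pt q i\<bar> \<le> 2 * s / real p)"
      using near[OF rt(2)] by blast
    \<comment> \<open>Label 0 has two causes: membership in \<open>A k\<close>, which is disjoint
      from \<open>B k\<close>, or position on the lower face, which \<open>B k\<close>
      avoids.\<close>
    have "pt r \<in> A k \<or> pt r k = c k - s"
      using rt(3) k by (auto simp: label_def pt_def split: if_splits)
    then have "pt r \<notin> B k" using disj[OF k] lower[OF k, of "pt r"] near[OF rt(1)] by blast
    then show "\<exists>y\<in>cube n c s. y \<notin> B k \<and> (\<forall>i. \<bar>y i - pt q i\<bar> \<le> 2 * s / real p)"
      using near[OF rt(1)] by blast
  qed
qed

text \<open>As the mesh tends to 0, the cells shrink to a point along a subsequence. The complements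
  of all \<open>A k\<close> and \<open>B k\<close> are relatively closed, so this point lies in
  every one of them.\<close>

lemma cube_not_covered:
  fixes A :: "nat \<Rightarrow> (nat \<Rightarrow> real) set"
  assumes s: "s > 0"
    and openA: "\<And>k. k < n \<Longrightarrow> openin (top_of_set (cube n c s)) (A k)"
    and openB: "\<And>k. k < n \<Longrightarrow> openin (top_of_set (cube n c s)) (B k)"
    and disj: "\<And>k. k < n \<Longrightarrow> A k \<inter> B k = {}"
    and upper: "\<And>k u. k < n \<Longrightarrow> u \<in> cube n c s \<Longrightarrow> u k = c k + s \<Longrightarrow> u \<notin> A k"
    and lower: "\<And>k u. k < n \<Longrightarrow> u \<in> cube n c s \<Longrightarrow> u k = c k - s \<Longrightarrow> u \<notin> B k"
  obtains u where "u \<in> cube n c s" "\<And>k. k < n \<Longrightarrow> u \<notin> A k \<and> u \<notin> B k"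
proof -
  have "\<forall>m. \<exists>x. x \<in> cube n c s \<and>
    (\<forall>k<n. \<exists>y\<in>cube n c s. y \<notin> A k \<and> (\<forall>i. \<bar>y i - x i\<bar> \<le> 2 * s / real (Suc m))) \<and>
    (\<forall>k<n. \<exists>y\<in>cube n c s. y \<notin> B k \<and> (\<forall>i. \<bar>y i - x i\<bar> \<le> 2 * s / real (Suc m)))"
  proof
    fix m
    show "\<exists>x. x \<in> cube n c s \<and>
      (\<forall>k<n. \<exists>y\<in>cube n c s. y \<notin> A k \<and> (\<forall>i. \<bar>y i - x i\<bar> \<le> 2 * s / real (Suc m))) \<and>
      (\<forall>k<n. \<exists>y\<in>cube n c s. y \<notin> B k \<and> (\<forall>i. \<bar>y i - x i\<bar> \<le> 2 * s / real (Suc m)))"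
      by (rule kuhn_cube_step[of s "Suc m" n A B c])
        (use s disj upper lower in \<open>simp_all del: of_nat_Suc, blast?\<close>)
  qed
  then obtain x where x: "\<And>m. x m \<in> cube n c s"
    "\<And>m k. k < n \<Longrightarrow> \<exists>y\<in>cube n c s. y \<notin> A k \<and> (\<forall>i. \<bar>y i - x m i\<bar> \<le> 2 * s / real (Suc m))"
    "\<And>m k. k < n \<Longrightarrow> \<exists>y\<in>cube n c s. y \<notin> B k \<and> (\<forall>i. \<bar>y i - x m i\<bar> \<le> 2 * s / real (Suc m))"
    by metis
  obtain u \<phi> where u: "u \<in> cube n c s" "strict_mono \<phi>" "(x \<circ> \<phi>) \<longlonglongrightarrow> u"
    using compact_imp_seq_compact[OF compact_cube] x(1) by (meson seq_compactE)
  have limit: "u \<notin> T" if T: "openin (top_of_set (cube n c s)) T"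
    and ex: "\<And>m. \<exists>y\<in>cube n c s. y \<notin> T \<and> (\<forall>i. \<bar>y i - x m i\<bar> \<le> 2 * s / real (Suc m))" for T
  proof
    assume "u \<in> T"
    obtain U where U: "open U" "T = cube n c s \<inter> U" using T by (auto simp: openin_open)
    obtain y where y: "\<And>m. y m \<in> cube n c s" "\<And>m. y m \<notin> T"
      "\<And>m i. \<bar>y m i - x m i\<bar> \<le> 2 * s / real (Suc m)" using ex by metis
    have "(\<lambda>m. y (\<phi> m) i) \<longlonglongrightarrow> u i" for i
    proof -
      have "(\<lambda>m. 2 * s / real (Suc m)) \<longlonglongrightarrow> 0"
        using tendsto_mult_right_zero[OF LIMSEQ_inverse_real_of_nat, of "2 * s"]
        by (simp add: divide_inverse)
      then have "(\<lambda>m. y m i - x m i) \<longlonglongrightarrow> 0"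
        by (rule Lim_null_comparison[rotated]) (use y(3) in auto)
      then have "(\<lambda>m. y (\<phi> m) i - x (\<phi> m) i) \<longlonglongrightarrow> 0"
        using LIMSEQ_subseq_LIMSEQ[OF _ u(2)] by (force simp: o_def)
      moreover have "(\<lambda>m. x (\<phi> m) i) \<longlonglongrightarrow> u i" using u(3) by (simp add: tendsto_fun_iff o_def)
      ultimately show ?thesis using tendsto_add by force
    qed
    then have "(\<lambda>m. y (\<phi> m)) \<longlonglongrightarrow> u" by (simp add: tendsto_fun_iff)
    then have "eventually (\<lambda>m. y (\<phi> m) \<in> U) sequentially"
      using U \<open>u \<in> T\<close> by (auto dest: topological_tendstoD)
    then show False using y(1,2) U(2) by simp
  qed
  show thesis
  proof (rule that[OF u(1)], intro conjI)
    fix k assume k: "k < n"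
    show "u \<notin> A k" by (rule limit[OF openA[OF k] x(2)[OF k]])
    show "u \<notin> B k" by (rule limit[OF openB[OF k] x(3)[OF k]])
  qed
qed

section \<open>Separation of compact sets and fine covers by balls\<close>

lemma compact_separated:
  fixes K L :: "'a::metric_space set"
  assumes "compact K" "compact L" "K \<inter> L = {}"
  obtains d where "d > 0" "\<And>x y. x \<in> K \<Longrightarrow> y \<in> L \<Longrightarrow> d \<le> dist x y"
proof (cases "K \<times> L = {}")
  case True
  then show ?thesis by (intro that[of 1]) auto
next
  case False
  have "continuous_on (K \<times> L) (\<lambda>p. dist (fst p) (snd p))" by (intro continuous_intros)
  then obtain p where p: "p \<in> K \<times> L" "\<forall>q\<in>K \<times> L. dist (fst p) (snd p) \<le> dist (fst q) (snd q)"
    using continuous_attains_inf[OF compact_Times[OF assms(1,2)] False] by blast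
  show ?thesis
  proof (rule that[of "dist (fst p) (snd p)"])
    show "dist (fst p) (snd p) > 0" using p(1) assms(3) by (auto simp: mem_Times_iff)
    show "dist (fst p) (snd p) \<le> dist x y" if "x \<in> K" "y \<in> L" for x y
      using p(2) that by force
  qed
qed

lemma compact_separated_family:
  fixes K L :: "nat \<Rightarrow> 'a::metric_space set"
  assumes "\<And>k. k < n \<Longrightarrow> compact (K k)" "\<And>k. k < n \<Longrightarrow> compact (L k)"
    "\<And>k. k < n \<Longrightarrow> K k \<inter> L k = {}"
  obtains d where "d > 0" "\<And>k x y. k < n \<Longrightarrow> x \<in> K k \<Longrightarrow> y \<in> L k \<Longrightarrow> d \<le> dist x y"
proof -
  have "\<forall>k. \<exists>d. k < n \<longrightarrow> d > 0 \<and> (\<forall>x\<in>K k. \<forall>y\<in>L k. d \<le> dist x y)"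
    using compact_separated assms by meson
  then obtain d where d: "\<And>k. k < n \<Longrightarrow> d k > 0"
    "\<And>k x y. k < n \<Longrightarrow> x \<in> K k \<Longrightarrow> y \<in> L k \<Longrightarrow> d k \<le> dist x y" by metis
  \<comment> \<open>The inserted 1 keeps the set nonempty when \<open>n = 0\<close>.\<close>
  define m where "m = Min (insert 1 (d ` {..<n}))"
  have "m > 0" unfolding m_def using d(1) by (subst Min_gr_iff) auto
  moreover have "m \<le> d k" if "k < n" for k unfolding m_def using that by (intro Min_le) auto
  ultimately show thesis using d(2) by (intro that[of m]) (assumption, meson order_trans)
qed

definition open_cube :: "nat \<Rightarrow> (nat \<Rightarrow> real) \<Rightarrow> real \<Rightarrow> (nat \<Rightarrow> real) set" where
  "open_cube n c s = {u. (\<forall>i<n. \<bar>u i - c i\<bar> < s) \<and> (\<forall>i\<ge>n. u i = 0)}"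

lemma openin_open_cube: "openin (top_of_set {u. \<forall>i\<ge>n. u i = 0}) (open_cube n c s)"
proof -
  have "open {u :: nat \<Rightarrow> real. \<forall>i\<in>{..<n}. u i \<in> ball (c i) s}"
    using product_topology_basis'[of "{..<n}" "\<lambda>i. ball (c i) s" "\<lambda>i. i"] by simp
  moreover have "open_cube n c s =
      {u. \<forall>i\<ge>n. u i = 0} \<inter> {u. \<forall>i\<in>{..<n}. u i \<in> ball (c i) s}"
    by (auto simp: open_cube_def dist_real_def abs_minus_commute)
  ultimately show ?thesis by (auto simp: openin_open)
qed

lemma open_cube_subset: assumes "s \<le> t" shows "open_cube n c s \<subseteq> cube n c t"
proof
  fix u assume u: "u \<in> open_cube n c s"
  have "\<bar>u i - c i\<bar> \<le> t" if "i < n" for i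
  proof -
    have "\<bar>u i - c i\<bar> < s" using u that by (simp add: open_cube_def)
    with assms show ?thesis by linarith
  qed
  then show "u \<in> cube n c t" using u by (simp add: open_cube_def cube_def)
qed

text \<open>The geometry is kept apart from computability: its only input is that every point lies
  in arbitrarily small balls of the family.\<close>

locale rational_balls =
  fixes center :: "nat \<Rightarrow> 'a::metric_space" and radius :: "nat \<Rightarrow> real"
  assumes dense: "e > 0 \<Longrightarrow> \<exists>i. dist (center i) x < radius i \<and> radius i < e"
begin

definition rb :: "nat \<Rightarrow> 'a set" where "rb i = ball (center i) (radius i)"

definition far :: "nat \<Rightarrow> nat \<Rightarrow> bool" where
  "far i j \<longleftrightarrow> radius i + radius j < dist (center i) (center j)"

lemma far_disjoint: assumes "far i j" shows "rb i \<inter> rb j = {}"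
proof -
  have False if "dist (center i) x < radius i" "dist (center j) x < radius j" for x
    using assms that dist_triangle2[of "center i" "center j" x] unfolding far_def by linarith
  then show ?thesis by (auto simp: rb_def)
qed

text \<open>The last clause keeps every ball close to \<open>K\<close>; otherwise distances between
  compact sets would not pass on to their covers.\<close>

definition fine_cover :: "real \<Rightarrow> 'a set \<Rightarrow> nat set \<Rightarrow> bool" where
  "fine_cover e K F \<longleftrightarrow> finite F \<and> K \<subseteq> (\<Union>i\<in>F. rb i) \<and> (\<forall>i\<in>F. radius i < e \<and> rb i \<inter> K \<noteq> {})"

lemma fine_cover_exists:
  assumes "compact K" "e > 0"
  obtains F where "fine_cover e K F"
proof -
  have "\<forall>x. \<exists>i. dist (center i) x < radius i \<and> radius i < e" using dense[OF assms(2)] by blast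
  then obtain f where "\<forall>x. dist (center (f x)) x < radius (f x) \<and> radius (f x) < e" by metis
  then have f: "\<And>x. x \<in> rb (f x)" "\<And>x. radius (f x) < e" by (auto simp: rb_def)
  obtain C where C: "C \<subseteq> K" "finite C" "K \<subseteq> (\<Union>x\<in>C. rb (f x))"
  proof (rule compactE_image[OF assms(1), of K "\<lambda>x. rb (f x)"])
    show "open (rb (f x))" for x by (simp add: rb_def)
    show "K \<subseteq> (\<Union>x\<in>K. rb (f x))" using f(1) by blast
  qed
  have "rb (f x) \<inter> K \<noteq> {}" if "x \<in> C" for x using f(1)[of x] C(1) that by blast
  then have "fine_cover e K (f ` C)" unfolding fine_cover_def using C f(2) by simp
  then show thesis by (rule that)
qed

text \<open>The centres lie within \<open>e\<close> of points at distance at least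
  \<open>4 * e\<close>, hence are more than \<open>2 * e\<close> apart, which exceeds the sum of the
  radii.\<close>

lemma fine_covers_far:
  assumes "fine_cover e K F" "fine_cover e L G" "i \<in> F" "j \<in> G"
    "\<And>x y. x \<in> K \<Longrightarrow> y \<in> L \<Longrightarrow> 4 * e \<le> dist x y"
  shows "far i j"
proof -
  obtain x y where xy: "x \<in> K" "y \<in> L" "x \<in> rb i" "y \<in> rb j"
    using assms(1-4) unfolding fine_cover_def by blast
  have "radius i < e" "radius j < e" using assms(1-4) by (auto simp: fine_cover_def)
  moreover have "dist (center i) x < radius i" "dist (center j) y < radius j"
    using xy by (auto simp: rb_def)
  moreover have "4 * e \<le> dist x y" using assms(5) xy by blast
  moreover have "dist x y \<le> dist (center i) x + dist (center i) (center j) + dist (center j) y"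
    using dist_triangle[of x y "center i"] dist_triangle[of "center i" y "center j"]
    by (simp add: dist_commute)
  ultimately show ?thesis unfolding far_def by linarith
qed

lemma fine_cover_avoids:
  assumes "fine_cover e K F" "i \<in> F" "\<And>x. x \<in> K \<Longrightarrow> 2 * e \<le> dist x y"
  shows "y \<notin> rb i"
proof
  assume "y \<in> rb i"
  obtain x where "x \<in> K" "x \<in> rb i" using assms(1,2) unfolding fine_cover_def by blast
  moreover have "radius i < e" using assms(1,2) by (simp add: fine_cover_def)
  ultimately show False
    using \<open>y \<in> rb i\<close> assms(3)[of x] dist_triangle3[of x y "center i"] by (simp add: rb_def)
qed

section \<open>The covering criterion\<close>

text \<open>\<open>A k\<close> and \<open>B k\<close> are required to be nonempty because a code
  always names a nonempty sequence.\<close>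

definition separation_criterion ::
  "'a set \<Rightarrow> nat \<Rightarrow> nat set \<Rightarrow> (nat \<Rightarrow> nat set) \<Rightarrow> (nat \<Rightarrow> nat set) \<Rightarrow> nat \<Rightarrow> bool" where
  "separation_criterion S n W P Q i \<longleftrightarrow> (\<exists>A B.
     (\<forall>k<n. finite (A k) \<and> finite (B k) \<and> A k \<noteq> {} \<and> B k \<noteq> {} \<and>
       (\<forall>a\<in>A k. \<forall>b\<in>B k. far a b) \<and> (\<forall>a\<in>A k. \<forall>p\<in>P k. far a p) \<and> (\<forall>b\<in>B k. \<forall>p\<in>Q k. far b p)) \<and>
     S \<subseteq> (\<Union>j\<in>W. rb j) \<union> rb i \<union> (\<Union>k<n. (\<Union>j\<in>A k. rb j) \<union> (\<Union>j\<in>B k. rb j)))"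

text \<open>Formal disjointness supplies the face conditions of \<open>cube_not_covered\<close>:
  \<open>P k\<close> covers the image of the upper face, so no ball of \<open>A k\<close> meets that
  image, and likewise for \<open>Q k\<close>, the lower face and \<open>B k\<close>.\<close>

lemma separation_criterion_sound:
  assumes crit: "separation_criterion S n W P Q i"
    and r: "r > 0" and g: "continuous_on (cube n c r) g" "g ` cube n c r \<subseteq> S"
    and W: "\<And>j. j \<in> W \<Longrightarrow> rb j \<inter> g ` cube n c r = {}"
    and P: "\<And>k. k < n \<Longrightarrow> g ` {u \<in> cube n c r. u k = c k + r} \<subseteq> (\<Union>j\<in>P k. rb j)"
    and Q: "\<And>k. k < n \<Longrightarrow> g ` {u \<in> cube n c r. u k = c k - r} \<subseteq> (\<Union>j\<in>Q k. rb j)"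
  shows "S \<inter> rb i \<noteq> {}"
proof
  assume empty: "S \<inter> rb i = {}"
  obtain A B where AB0: "\<forall>k<n. finite (A k) \<and> finite (B k) \<and> A k \<noteq> {} \<and> B k \<noteq> {} \<and>
       (\<forall>a\<in>A k. \<forall>b\<in>B k. far a b) \<and> (\<forall>a\<in>A k. \<forall>p\<in>P k. far a p) \<and> (\<forall>b\<in>B k. \<forall>p\<in>Q k. far b p)"
    and cover: "S \<subseteq> (\<Union>j\<in>W. rb j) \<union> rb i \<union> (\<Union>k<n. (\<Union>j\<in>A k. rb j) \<union> (\<Union>j\<in>B k. rb j))"
    using crit unfolding separation_criterion_def by (elim exE conjE)
  have AB: "\<And>k a b. k < n \<Longrightarrow> a \<in> A k \<Longrightarrow> b \<in> B k \<Longrightarrow> far a b"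
    "\<And>k a p. k < n \<Longrightarrow> a \<in> A k \<Longrightarrow> p \<in> P k \<Longrightarrow> far a p"
    "\<And>k b p. k < n \<Longrightarrow> b \<in> B k \<Longrightarrow> p \<in> Q k \<Longrightarrow> far b p"
    using AB0 by simp_all
  define pre where "pre = (\<lambda>F. cube n c r \<inter> g -` (\<Union>j\<in>F. rb j))"
  have open_pre: "openin (top_of_set (cube n c r)) (pre F)" for F
    unfolding pre_def by (rule continuous_openin_preimage_gen[OF g(1)]) (auto simp: rb_def)
  have disj: "(\<Union>j\<in>F. rb j) \<inter> (\<Union>j\<in>G. rb j) = {}" if "\<And>a b. a \<in> F \<Longrightarrow> b \<in> G \<Longrightarrow> far a b" for F G
    using far_disjoint that by blast
  obtain u where u: "u \<in> cube n c r" "\<And>k. k < n \<Longrightarrow> u \<notin> pre (A k) \<and> u \<notin> pre (B k)"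
  proof (rule cube_not_covered[OF r, of n c "\<lambda>k. pre (A k)" "\<lambda>k. pre (B k)"])
    fix k assume k: "k < n"
    show "pre (A k) \<inter> pre (B k) = {}"
      using disj[of "A k" "B k", OF AB(1)[OF k]] by (auto simp: pre_def)
    fix u assume u: "u \<in> cube n c r"
    show "u \<notin> pre (A k)" if "u k = c k + r"
    proof -
      have "g u \<in> (\<Union>j\<in>P k. rb j)" using P[OF k] u that by blast
      then show ?thesis using disj[of "A k" "P k", OF AB(2)[OF k]] unfolding pre_def by blast
    qed
    show "u \<notin> pre (B k)" if "u k = c k - r"
    proof -
      have "g u \<in> (\<Union>j\<in>Q k. rb j)" using Q[OF k] u that by blast
      then show ?thesis using disj[of "B k" "Q k", OF AB(3)[OF k]] unfolding pre_def by blast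
    qed
  next
    fix u assume "u \<in> cube n c r" "\<And>k. k < n \<Longrightarrow> u \<notin> pre (A k) \<and> u \<notin> pre (B k)"
    then show thesis by (rule that)
  qed (rule open_pre)+
  have "g u \<in> S" using g(2) u(1) by blast
  have "g u \<notin> (\<Union>j\<in>A k. rb j) \<union> (\<Union>j\<in>B k. rb j)" if "k < n" for k
    using u(1) u(2)[OF that] unfolding pre_def by blast
  then have "g u \<notin> (\<Union>k<n. (\<Union>j\<in>A k. rb j) \<union> (\<Union>j\<in>B k. rb j))" by (simp only: UN_iff) blast
  moreover have "g u \<notin> rb i" using empty \<open>g u \<in> S\<close> by blast
  moreover have "g u \<notin> (\<Union>j\<in>W. rb j)" using W u(1) by blast
  ultimately show False using subsetD[OF cover \<open>g u \<in> S\<close>] by (simp only: Un_iff) simp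
qed

lemma fine_cover_mono: "fine_cover d K F \<Longrightarrow> d \<le> e \<Longrightarrow> fine_cover e K F"
  by (fastforce simp: fine_cover_def)

text \<open>Around a point \<open>z\<close> with \<open>g z\<close> in the given ball, a cube minus a small cube is the union of the
  sectors \<open>A k\<close> and \<open>B k\<close> on which the \<open>k\<close>-th coordinate of \<open>u - z\<close> is the largest in absolute value
  and negative, respectively positive.\<close>

lemma separation_criterion_complete:
  assumes r: "r > 0" and e: "e > 0"
    and g: "continuous_on (cube n c (2 * r)) g" "inj_on g (cube n c (2 * r))"
    and S: "S \<subseteq> (\<Union>j\<in>W. rb j) \<union> g ` cube n c (2 * r)"
    and P: "\<And>k. k < n \<Longrightarrow> fine_cover e (g ` {u \<in> cube n c r. u k = c k + r}) (P k)"
    and Q: "\<And>k. k < n \<Longrightarrow> fine_cover e (g ` {u \<in> cube n c r. u k = c k - r}) (Q k)"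
    and sepP: "\<And>k u v. k < n \<Longrightarrow> u \<in> cube n c (2 * r) \<Longrightarrow> u k \<le> c k + r / 2 \<Longrightarrow>
      v \<in> cube n c r \<Longrightarrow> v k = c k + r \<Longrightarrow> 4 * e \<le> dist (g u) (g v)"
    and sepQ: "\<And>k u v. k < n \<Longrightarrow> u \<in> cube n c (2 * r) \<Longrightarrow> c k - r / 2 \<le> u k \<Longrightarrow>
      v \<in> cube n c r \<Longrightarrow> v k = c k - r \<Longrightarrow> 4 * e \<le> dist (g u) (g v)"
    and z: "z \<in> open_cube n c (r / 2)" "g z \<in> rb i"
  shows "separation_criterion S n W P Q i"
proof -
  have z_near: "\<bar>z k - c k\<bar> < r / 2" if "k < n" for k using z(1) that by (simp add: open_cube_def)
  have z_tail: "\<forall>k\<ge>n. z k = 0" using z(1) by (simp add: open_cube_def)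
  have "openin (top_of_set (cube n c (2 * r))) (cube n c (2 * r) \<inter> g -` rb i)"
    by (rule continuous_openin_preimage_gen[OF g(1)]) (simp add: rb_def)
  then obtain U where U: "open U" "cube n c (2 * r) \<inter> g -` rb i = cube n c (2 * r) \<inter> U"
    by (auto simp: openin_open)
  have "z \<in> cube n c (2 * r)" using open_cube_subset[of "r / 2" "2 * r" n c] z(1) r by auto
  then have "z \<in> U" using U(2) z(2) by blast
  then obtain s1 where s1: "s1 > 0" "cube n z s1 \<subseteq> U" using cube_subset_open U(1) z_tail by metis
  \<comment> \<open>The bound \<open>s1\<close> keeps the small cube in the preimage of the ball;
    \<open>r / 2\<close> keeps it in the large cube, as \<open>z\<close> is within
    \<open>r / 2\<close> of \<open>c\<close>.\<close>
  define s where "s = min s1 (r / 2)"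
  have s: "s > 0" "s \<le> r / 2" "cube n z s \<subseteq> U"
    using s1 r cube_mono[of s s1 n z] by (auto simp: s_def)
  have near_cube: "cube n z s \<subseteq> cube n c (2 * r)"
  proof
    fix u assume u: "u \<in> cube n z s"
    have "\<bar>u k - c k\<bar> \<le> 2 * r" if "k < n" for k
    proof -
      have "\<bar>u k - z k\<bar> \<le> s" using u that by (simp add: cube_def)
      then show ?thesis using z_near[OF that] s(2) r by linarith
    qed
    then show "u \<in> cube n c (2 * r)" using u by (simp add: cube_def)
  qed
  define A where "A = (\<lambda>k. cube n c (2 * r) \<inter> {u. s \<le> z k - u k \<and> (\<forall>j. j < n \<longrightarrow> \<bar>u j - z j\<bar> \<le> z k - u k)})"
  define B where "B = (\<lambda>k. cube n c (2 * r) \<inter> {u. s \<le> u k - z k \<and> (\<forall>j. j < n \<longrightarrow> \<bar>u j - z j\<bar> \<le> u k - z k)})"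
  have coord: "continuous_on UNIV (\<lambda>u :: nat \<Rightarrow> real. u k)" for k by simp
  have closed: "compact (A k)" "compact (B k)" for k
    unfolding A_def B_def
    by (intro compact_Int_closed compact_cube closed_Collect_conj closed_Collect_all closed_Collect_imp
        closed_Collect_le continuous_on_diff continuous_on_const continuous_on_rabs coord open_Collect_const)+
  have sub: "A k \<subseteq> cube n c (2 * r)" "B k \<subseteq> cube n c (2 * r)" for k by (auto simp: A_def B_def)
  have compact: "compact (g ` A k)" "compact (g ` B k)" for k
    by (rule compact_continuous_image[OF continuous_on_subset[OF g(1)]]; rule sub closed)+
  have "A k \<inter> B k = {}" for k using s(1) by (auto simp: A_def B_def)
  then have disj: "g ` A k \<inter> g ` B k = {}" for k
    by (simp add: inj_on_image_Int[OF g(2) sub, symmetric])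
  obtain d where d: "d > 0" "\<And>k x y. k < n \<Longrightarrow> x \<in> g ` A k \<Longrightarrow> y \<in> g ` B k \<Longrightarrow> d \<le> dist x y"
    using compact_separated_family[of n "\<lambda>k. g ` A k" "\<lambda>k. g ` B k", OF compact disj] by metis
  \<comment> \<open>Fineness \<open>e\<close> puts the covers far from the fixed families
    \<open>P k\<close> and \<open>Q k\<close>; fineness \<open>d / 4\<close> puts the covers of
    opposite sectors far from each other. Since \<open>d\<close> depends on \<open>z\<close> and the
    ball, these covers cannot be fixed in advance.\<close>
  define f where "f = min e (d / 4)"
  have f: "f > 0" "f \<le> e" "4 * f \<le> d" using e d(1) by (auto simp: f_def)
  have "\<exists>F. fine_cover f (g ` A k) F" "\<exists>G. fine_cover f (g ` B k) G" for k
    using fine_cover_exists[OF _ f(1)] compact by meson+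
  then obtain F G where F: "\<And>k. fine_cover f (g ` A k) (F k)"
    and G: "\<And>k. fine_cover f (g ` B k) (G k)" by metis
  have cover: "x \<in> (\<Union>j\<in>W. rb j) \<union> rb i \<union> (\<Union>k<n. (\<Union>j\<in>F k. rb j) \<union> (\<Union>j\<in>G k. rb j))"
    if x: "x \<in> S" for x
  proof (cases "x \<in> (\<Union>j\<in>W. rb j) \<union> rb i")
    case False
    then obtain u where u: "u \<in> cube n c (2 * r)" "x = g u" using S x by blast
    have "u \<notin> cube n z s" using False u(2) s(3) U(2) near_cube by blast
    then obtain j where j: "j < n" "\<bar>u j - z j\<bar> > s" using u(1) by (auto simp: cube_def not_le)
    \<comment> \<open>The coordinate deviating most from \<open>z\<close> decides the sector; its
      deviation is at least \<open>s\<close> because \<open>u\<close> lies outside the small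
      cube.\<close>
    have "Max ((\<lambda>k. \<bar>u k - z k\<bar>) ` {..<n}) \<in> (\<lambda>k. \<bar>u k - z k\<bar>) ` {..<n}"
      using j by (intro Max_in) auto
    then obtain k where k: "k < n" "\<bar>u k - z k\<bar> = Max ((\<lambda>k. \<bar>u k - z k\<bar>) ` {..<n})" by auto
    have max: "\<bar>u l - z l\<bar> \<le> \<bar>u k - z k\<bar>" if "l < n" for l
      unfolding k(2) using that by (intro Max_ge) auto
    have big: "s \<le> \<bar>u k - z k\<bar>" using max[OF j(1)] j(2) by linarith
    have "u \<in> A k \<or> u \<in> B k"
    proof (cases "u k \<le> z k")
      case True
      then have "\<bar>u k - z k\<bar> = z k - u k" by simp
      then show ?thesis using u(1) max big by (simp add: A_def)
    next
      case False
      then have "\<bar>u k - z k\<bar> = u k - z k" by simp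
      then show ?thesis using u(1) max big by (simp add: B_def)
    qed
    then have "x \<in> (\<Union>j\<in>F k. rb j) \<union> (\<Union>j\<in>G k. rb j)"
      using F[of k] G[of k] u(2) by (auto simp: fine_cover_def)
    then show ?thesis using k(1) by blast
  qed blast
  have props: "finite (F k) \<and> finite (G k) \<and> F k \<noteq> {} \<and> G k \<noteq> {} \<and>
       (\<forall>a\<in>F k. \<forall>b\<in>G k. far a b) \<and> (\<forall>a\<in>F k. \<forall>p\<in>P k. far a p) \<and> (\<forall>b\<in>G k. \<forall>p\<in>Q k. far b p)"
    if k: "k < n" for k
  proof (intro conjI ballI)
    show "finite (F k)" "finite (G k)" using F G by (auto simp: fine_cover_def)
    \<comment> \<open>The two points at distance \<open>s\<close> from \<open>z\<close> along the
      \<open>k\<close>-th axis lie in the two sectors, so the covers of these are nonempty.\<close>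
    have "z(k := z k - s) \<in> cube n z s" "z(k := z k + s) \<in> cube n z s"
      using s(1) z_tail k by (auto simp: cube_def)
    then have "z(k := z k - s) \<in> cube n c (2 * r)" "z(k := z k + s) \<in> cube n c (2 * r)"
      using near_cube by blast+
    then have "z(k := z k - s) \<in> A k" "z(k := z k + s) \<in> B k"
      using s(1) by (auto simp: A_def B_def)
    then show "F k \<noteq> {}" "G k \<noteq> {}" using F[of k] G[of k] by (auto simp: fine_cover_def)
    show "far a b" if "a \<in> F k" "b \<in> G k" for a b
      by (rule fine_covers_far[OF F G that], rule order_trans[OF f(3) d(2)[OF k]])
    show "far a p" if a: "a \<in> F k" "p \<in> P k" for a p
    proof (rule fine_covers_far[OF fine_cover_mono[OF F f(2)] P[OF k] a])
      fix x y assume "x \<in> g ` A k" "y \<in> g ` {u \<in> cube n c r. u k = c k + r}"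
      then obtain u v where uv: "u \<in> A k" "v \<in> cube n c r" "v k = c k + r" "x = g u" "y = g v" by blast
      \<comment> \<open>The sector lies below \<open>z k\<close>, which is within
        \<open>r / 2\<close> of \<open>c k\<close>, so it keeps away from the upper face at
        \<open>c k + r\<close>.\<close>
      have "s \<le> z k - u k" using uv(1) by (simp add: A_def)
      then have "u k \<le> c k + r / 2" using s(1) z_near[OF k] by linarith
      then show "4 * e \<le> dist x y"
        unfolding uv(4,5) using sepP[OF k _ _ uv(2,3)] subsetD[OF sub(1) uv(1)] by blast
    qed
    show "far a p" if a: "a \<in> G k" "p \<in> Q k" for a p
    proof (rule fine_covers_far[OF fine_cover_mono[OF G f(2)] Q[OF k] a])
      fix x y assume "x \<in> g ` B k" "y \<in> g ` {u \<in> cube n c r. u k = c k - r}"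
      then obtain u v where uv: "u \<in> B k" "v \<in> cube n c r" "v k = c k - r" "x = g u" "y = g v" by blast
      have "s \<le> u k - z k" using uv(1) by (simp add: B_def)
      then have "c k - r / 2 \<le> u k" using s(1) z_near[OF k] by linarith
      then show "4 * e \<le> dist x y"
        unfolding uv(4,5) using sepQ[OF k _ _ uv(2,3)] subsetD[OF sub(2) uv(1)] by blast
    qed
  qed
  show ?thesis
    unfolding separation_criterion_def
    by (rule exI[of _ F], rule exI[of _ G], rule conjI, intro allI impI props) (assumption, rule subsetI[OF cover])
qed

text \<open>Three nested cubes around the coordinates of \<open>x\<close> have radii
  \<open>r / 2\<close>, \<open>r\<close> and \<open>2 * r\<close>: \<open>V\<close> is the image of
  the open innermost one, \<open>P\<close> and \<open>Q\<close> cover the faces of the middle one,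
  and \<open>W\<close> covers what lies outside the open outermost one while missing the middle one.
  The gaps between the cubes give positive distances that depend on the chart only, so
  \<open>W\<close>, \<open>P\<close>, \<open>Q\<close> are fixed before \<open>i\<close> is
  known.\<close>

lemma separation_criterion_chart:
  fixes g :: "(nat \<Rightarrow> real) \<Rightarrow> 'a"
  assumes S: "compact S" and U: "openin (top_of_set S) U" "x \<in> U" "U \<subseteq> N" "N \<subseteq> S"
    and hom: "homeomorphism {u. \<forall>i\<ge>n. u i = 0} N g h"
  obtains W P Q V where "finite W" "\<And>k. k < n \<Longrightarrow> finite (P k) \<and> finite (Q k)"
    "openin (top_of_set S) V" "x \<in> V"
    "\<And>i. separation_criterion S n W P Q i \<Longrightarrow> S \<inter> rb i \<noteq> {}"
    "\<And>i. V \<inter> rb i \<noteq> {} \<Longrightarrow> separation_criterion S n W P Q i"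
proof -
  define E where "E = {u :: nat \<Rightarrow> real. \<forall>i\<ge>n. u i = 0}"
  note hom = hom[folded E_def]
  have g: "continuous_on E g" "g ` E = N" "\<And>u. u \<in> E \<Longrightarrow> h (g u) = u" "\<And>y. y \<in> N \<Longrightarrow> g (h y) = y"
    "h ` N = E"
    using hom by (auto simp: homeomorphism_def)
  have cubeE: "cube n c s \<subseteq> E" "open_cube n c s \<subseteq> E" for c s
    by (auto simp: cube_def open_cube_def E_def)
  define c where "c = h x"
  have x: "x \<in> N" using U by blast
  then have c: "c \<in> E" "g c = x" using g by (auto simp: c_def)
  have "openin (top_of_set N) U" by (rule openin_subset_trans[OF U(1,3,4)])
  then have "openin (top_of_set E) (E \<inter> g -` U)"
    using continuous_openin_preimage[OF g(1), of N U] g(2) by blast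
  then obtain T where T: "open T" "E \<inter> g -` U = E \<inter> T" by (auto simp: openin_open)
  have "c \<in> T" using T(2) c U(2) by blast
  then obtain R where R: "R > 0" "cube n c R \<subseteq> T"
    using cube_subset_open[OF T(1), of c n] c(1) by (auto simp: E_def)
  define r where "r = R / 2"
  have r: "r > 0" using R by (simp add: r_def)
  have "cube n c (2 * r) \<subseteq> E \<inter> T" using R(2) cubeE(1)[of c "2 * r"] by (auto simp: r_def)
  then have gU: "g ` cube n c (2 * r) \<subseteq> U" using T(2) by blast
  have small: "cube n c r \<subseteq> cube n c (2 * r)" using r by (intro cube_mono) simp
  have cont: "continuous_on (cube n c s) g" for s by (rule continuous_on_subset[OF g(1) cubeE(1)])
  have "inj_on g E" using g(3) by (rule inj_on_inverseI)
  then have inj: "inj_on g (cube n c (2 * r))" by (rule inj_on_subset) (rule cubeE)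
  \<comment> \<open>The chart gives openness in \<open>N\<close> only. As the image lies in
    \<open>U\<close>, which is open in \<open>S\<close>, it is open in \<open>S\<close> too.\<close>
  have open_image: "openin (top_of_set S) (g ` open_cube n c s)" if "s \<le> 2 * r" for s
  proof -
    have "openin (top_of_set N) (g ` open_cube n c s)"
      using openin_open_cube[of n c s] by (intro homeomorphism_imp_open_map[OF hom]) (simp add: E_def)
    moreover have "g ` open_cube n c s \<subseteq> U" using open_cube_subset[OF that] gU by blast
    ultimately show ?thesis using openin_subset_trans[OF _ _ U(3)] openin_trans U(1) by blast
  qed
  have compact_cond: "compact (g ` {u \<in> cube n c s. Pr u})" if "closed {u. Pr u}" "s \<le> 2 * r" for s Pr
  proof (rule compact_continuous_image)
    show "continuous_on {u \<in> cube n c s. Pr u} g" by (rule continuous_on_subset[OF cont]) blast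
    have "{u \<in> cube n c s. Pr u} = cube n c s \<inter> {u. Pr u}" by blast
    then show "compact {u \<in> cube n c s. Pr u}" using compact_Int_closed[OF compact_cube that(1)] by simp
  qed
  have coord: "continuous_on UNIV (\<lambda>u :: nat \<Rightarrow> real. u k)" for k by simp
  have closed: "closed {u :: nat \<Rightarrow> real. u k \<le> a}" "closed {u :: nat \<Rightarrow> real. a \<le> u k}"
    "closed {u :: nat \<Rightarrow> real. u k = a}" for k a
    by (intro closed_Collect_le closed_Collect_eq coord continuous_on_const)+
  have disj: "g ` {u \<in> cube n c (2 * r). Pr u} \<inter> g ` {u \<in> cube n c r. Pr' u} = {}"
    if "\<And>u. Pr u \<Longrightarrow> Pr' u \<Longrightarrow> False" for Pr Pr'
    using inj small that unfolding inj_on_def by blast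
  obtain d1 where d1: "d1 > 0" "\<And>k x y. k < n \<Longrightarrow> x \<in> g ` {u \<in> cube n c (2 * r). u k \<le> c k + r / 2} \<Longrightarrow>
      y \<in> g ` {u \<in> cube n c r. u k = c k + r} \<Longrightarrow> d1 \<le> dist x y"
  proof (rule compact_separated_family[of n "\<lambda>k. g ` {u \<in> cube n c (2 * r). u k \<le> c k + r / 2}"
        "\<lambda>k. g ` {u \<in> cube n c r. u k = c k + r}"])
    show "g ` {u \<in> cube n c (2 * r). u k \<le> c k + r / 2} \<inter> g ` {u \<in> cube n c r. u k = c k + r} = {}" for k
      by (rule disj) (use r in auto)
  qed (use r in \<open>auto intro: compact_cond closed\<close>)
  obtain d2 where d2: "d2 > 0" "\<And>k x y. k < n \<Longrightarrow> x \<in> g ` {u \<in> cube n c (2 * r). c k - r / 2 \<le> u k} \<Longrightarrow>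
      y \<in> g ` {u \<in> cube n c r. u k = c k - r} \<Longrightarrow> d2 \<le> dist x y"
  proof (rule compact_separated_family[of n "\<lambda>k. g ` {u \<in> cube n c (2 * r). c k - r / 2 \<le> u k}"
        "\<lambda>k. g ` {u \<in> cube n c r. u k = c k - r}"])
    show "g ` {u \<in> cube n c (2 * r). c k - r / 2 \<le> u k} \<inter> g ` {u \<in> cube n c r. u k = c k - r} = {}" for k
      by (rule disj) (use r in auto)
  qed (use r in \<open>auto intro: compact_cond closed\<close>)
  \<comment> \<open>The factor 4 is the one demanded by \<open>fine_covers_far\<close>.\<close>
  define e where "e = min d1 d2 / 4"
  have e: "e > 0" "4 * e \<le> d1" "4 * e \<le> d2" using d1(1) d2(1) by (auto simp: e_def)
  have "r \<le> 2 * r" using r by simp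
  have ex: "\<exists>F. fine_cover e (g ` {u \<in> cube n c r. u k = a}) F" for k a
    by (rule fine_cover_exists[OF compact_cond[OF closed(3) \<open>r \<le> 2 * r\<close>] e(1)]) (rule exI)
  obtain P where P: "\<And>k. fine_cover e (g ` {u \<in> cube n c r. u k = c k + r}) (P k)"
    using choice[of "\<lambda>k F. fine_cover e (g ` {u \<in> cube n c r. u k = c k + r}) F"] ex by auto
  obtain Q where Q: "\<And>k. fine_cover e (g ` {u \<in> cube n c r. u k = c k - r}) (Q k)"
    using choice[of "\<lambda>k F. fine_cover e (g ` {u \<in> cube n c r. u k = c k - r}) F"] ex by auto
  define K where "K = S - g ` open_cube n c (2 * r)"
  have "closedin (top_of_set S) K"
    unfolding K_def by (rule closedin_diff[OF _ open_image]) auto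
  then have K: "compact K" by (rule closedin_compact[OF S])
  have KL: "K \<inter> g ` cube n c r = {}"
  proof -
    have "cube n c r \<subseteq> open_cube n c (2 * r)" using r by (force simp: cube_def open_cube_def)
    then show ?thesis unfolding K_def by blast
  qed
  obtain d where d: "d > 0" "\<And>x y. x \<in> K \<Longrightarrow> y \<in> g ` cube n c r \<Longrightarrow> d \<le> dist x y"
    using compact_separated[OF K compact_continuous_image[OF cont compact_cube] KL] by blast
  \<comment> \<open>At fineness \<open>d / 2\<close> a ball touching \<open>K\<close> has diameter
    less than \<open>d\<close>, so it cannot reach the middle cube.\<close>
  obtain W where W: "fine_cover (d / 2) K W" using fine_cover_exists[OF K, of "d / 2"] d(1) by auto
  have fin: "finite W" "\<And>k. finite (P k) \<and> finite (Q k)" using W P Q by (simp_all add: fine_cover_def)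
  have sound: "S \<inter> rb i \<noteq> {}" if "separation_criterion S n W P Q i" for i
  proof (rule separation_criterion_sound[OF that r cont])
    show "g ` cube n c r \<subseteq> S" using gU small U(3,4) by blast
    show "rb j \<inter> g ` cube n c r = {}" if "j \<in> W" for j
      using fine_cover_avoids[OF W that] d(2) by auto
  qed (use P Q in \<open>simp_all add: fine_cover_def\<close>)
  have complete: "separation_criterion S n W P Q i" if meets: "g ` open_cube n c (r / 2) \<inter> rb i \<noteq> {}" for i
  proof -
    obtain z where z: "z \<in> open_cube n c (r / 2)" "g z \<in> rb i" using meets by blast
    show ?thesis
    proof (rule separation_criterion_complete[OF r e(1) cont inj _ P Q _ _ z])
      show "S \<subseteq> (\<Union>j\<in>W. rb j) \<union> g ` cube n c (2 * r)"
        using W open_cube_subset[OF order_refl, of n c "2 * r"] unfolding fine_cover_def K_def by blast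
      show "4 * e \<le> dist (g u) (g v)" if "k < n" "u \<in> cube n c (2 * r)" "u k \<le> c k + r / 2"
        "v \<in> cube n c r" "v k = c k + r" for k u v
        by (rule order_trans[OF e(2) d1(2)[OF that(1)]]) (use that in auto)
      show "4 * e \<le> dist (g u) (g v)" if "k < n" "u \<in> cube n c (2 * r)" "c k - r / 2 \<le> u k"
        "v \<in> cube n c r" "v k = c k - r" for k u v
        by (rule order_trans[OF e(3) d2(2)[OF that(1)]]) (use that in auto)
    qed
  qed
  show thesis
  proof (rule that[OF fin(1) fin(2) open_image _ sound complete])
    show "x \<in> g ` open_cube n c (r / 2)" using c r by (force simp: open_cube_def E_def)
  qed (use r in auto)
qed

end

section \<open>Enumerability of the criterion\<close>

lemma re_ball_finite:
  assumes "finite A" "\<And>a. a \<in> A \<Longrightarrow> re n (P a)" shows "re n (\<lambda>xs. \<forall>a\<in>A. P a xs)"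
  using assms by (induction A rule: finite_induct) (auto intro: re_const re_conj)

text \<open>Negative terms are moved to the other side, so that no truncated subtraction occurs.\<close>

lemma fraction_less_iff_nat:
  fixes A B C a b c a' b' c' e :: nat
  shows "(real a - real b) / (real c + 1) + (real a' - real b') / (real c' + 1) + (1 / 2) ^ e
      < (real A - real B) / (real C + 1) \<longleftrightarrow>
    B * (Suc c * Suc c' * 2 ^ e) + a * (Suc C * Suc c' * 2 ^ e) + a' * (Suc C * Suc c * 2 ^ e) +
      Suc C * Suc c * Suc c' <
    A * (Suc c * Suc c' * 2 ^ e) + b * (Suc C * Suc c' * 2 ^ e) + b' * (Suc C * Suc c * 2 ^ e)"
proof -
  define P Q R T where "P = real C + 1" "Q = real c + 1" "R = real c' + 1" "T = (2::real) ^ e"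
  have pos: "P > 0" "Q > 0" "R > 0" "T > 0" by (simp_all add: P_Q_R_T_def)
  have "(real a - real b) / Q + (real a' - real b') / R + 1 / T < (real A - real B) / P \<longleftrightarrow>
      ((real a - real b) / Q + (real a' - real b') / R + 1 / T) * (P * Q * R * T) <
      (real A - real B) / P * (P * Q * R * T)"
    using pos by (intro mult_less_cancel_right_pos[symmetric]) simp
  also have "((real a - real b) / Q + (real a' - real b') / R + 1 / T) * (P * Q * R * T) =
      (real a - real b) * (P * R * T) + (real a' - real b') * (P * Q * T) + P * Q * R"
    using pos by (simp add: field_simps)
  also have "(real A - real B) / P * (P * Q * R * T) = (real A - real B) * (Q * R * T)"
    using pos by simp
  also have "(real a - real b) * (P * R * T) + (real a' - real b') * (P * Q * T) + P * Q * R <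
      (real A - real B) * (Q * R * T) \<longleftrightarrow>
      real B * (Q * R * T) + real a * (P * R * T) + real a' * (P * Q * T) + P * Q * R <
      real A * (Q * R * T) + real b * (P * R * T) + real b' * (P * Q * T)"
    by (auto simp: algebra_simps)
  also have "\<dots> \<longleftrightarrow> real (B * (Suc c * Suc c' * 2 ^ e) + a * (Suc C * Suc c' * 2 ^ e) +
      a' * (Suc C * Suc c * 2 ^ e) + Suc C * Suc c * Suc c') <
    real (A * (Suc c * Suc c' * 2 ^ e) + b * (Suc C * Suc c' * 2 ^ e) + b' * (Suc C * Suc c * 2 ^ e))"
    by (simp only: P_Q_R_T_def of_nat_add of_nat_mult of_nat_Suc of_nat_power of_nat_numeral add.commute)
  also have "\<dots> \<longleftrightarrow> B * (Suc c * Suc c' * 2 ^ e) + a * (Suc C * Suc c' * 2 ^ e) +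
      a' * (Suc C * Suc c * 2 ^ e) + Suc C * Suc c * Suc c' <
    A * (Suc c * Suc c' * 2 ^ e) + b * (Suc C * Suc c' * 2 ^ e) + b' * (Suc C * Suc c * 2 ^ e)"
    by (rule of_nat_less_iff)
  finally show ?thesis by (simp add: P_Q_R_T_def power_one_over)
qed

text \<open>A strict lower bound for a computable real is confirmed at some finite precision, which
  turns the comparison into a search over \<open>e\<close>.\<close>

lemma approximation_less_iff:
  fixes y :: real and f :: "nat \<Rightarrow> real"
  assumes "\<And>e. \<bar>y - f e\<bar> < (1/2) ^ e"
  shows "x < y \<longleftrightarrow> (\<exists>e. x + (1/2) ^ e < f e)"
proof
  assume "x < y"
  \<comment> \<open>Half the gap, because the error is spent twice: once in \<open>f e\<close> and
    once in the threshold.\<close>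
  then obtain e where "(1/2) ^ e < (y - x) / 2"
    using real_arch_pow_inv[of "(y - x) / 2" "1/2"] by auto
  then show "\<exists>e. x + (1/2) ^ e < f e" using assms[of e]
    by (intro exI[of _ e]) (simp add: abs_less_iff)
next
  assume "\<exists>e. x + (1/2) ^ e < f e"
  then obtain e where "x + (1/2) ^ e < f e" by blast
  then show "x < y" using assms[of e] by linarith
qed

lemma re_rat_sum_less_real:
  assumes "computable_real2 D" "computable_rat_seq q"
    and rec: "recursive n x" "recursive n y" "recursive n u" "recursive n v"
  shows "re n (\<lambda>xs. of_rat (q (u xs)) + of_rat (q (v xs)) < D (x xs) (y xs))"
proof -
  obtain A B C where ABC: "computable3 A" "computable3 B" "computable3 C"
    "\<And>x y i. \<bar>D x y - (real (A x y i) - real (B x y i)) / (real (C x y i) + 1)\<bar> < (1/2) ^ i"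
    using assms(1) unfolding computable_real2_def by blast
  obtain a b c where abc: "computable1 a" "computable1 b" "computable1 c"
    "\<And>i. q i = (of_nat (a i) - of_nat (b i)) / (of_nat (c i) + 1)"
    using assms(2) unfolding computable_rat_seq_def by blast
  have q: "real_of_rat (q i) = (real (a i) - real (b i)) / (real (c i) + 1)" for i
    by (simp add: abc(4) of_rat_divide of_rat_diff of_rat_add)
  note lifts = rec[THEN recursive_lift]
  show ?thesis
    unfolding approximation_less_iff[OF ABC(4)] q fraction_less_iff_nat
    by (intro re_ex re_less recursive_add recursive_mult recursive_Suc recursive_power lifts recursive_vars
        recursive_comp3[OF ABC(1)] recursive_comp3[OF ABC(2)] recursive_comp3[OF ABC(3)]
        recursive_comp1[OF abc(1)] recursive_comp1[OF abc(2)] recursive_comp1[OF abc(3)])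
qed

context rational_balls
begin

definition code_union :: "(nat \<Rightarrow> nat \<Rightarrow> nat) \<Rightarrow> (nat \<Rightarrow> nat) \<Rightarrow> nat \<Rightarrow> 'a set" where
  "code_union \<sigma> \<eta> j = (\<Union>i\<in>{\<sigma> j k | k. k \<le> \<eta> j}. rb i)"

text \<open>The entries \<open>\<sigma> v (2 * k)\<close> and \<open>\<sigma> v (2 * k + 1)\<close> of the sequence \<open>v\<close> are codes of the families
  \<open>A k\<close> and \<open>B k\<close>.\<close>

lemma separation_criterion_code:
  assumes range: "range (\<lambda>j. map (\<sigma> j) [0..<Suc (\<eta> j)]) = {l. l \<noteq> []}"
    and fin: "finite W"
  shows "separation_criterion S n W P Q i \<longleftrightarrow> (\<exists>m v. S \<subseteq> code_union \<sigma> \<eta> m \<and>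
     (\<forall>t<Suc (\<eta> m). (\<exists>w\<in>W. \<sigma> m t = w) \<or> \<sigma> m t = i \<or>
        (\<exists>k\<in>{..<n}. (\<exists>s. s < Suc (\<eta> (\<sigma> v (2 * k))) \<and> \<sigma> m t = \<sigma> (\<sigma> v (2 * k)) s) \<or>
           (\<exists>s. s < Suc (\<eta> (\<sigma> v (2 * k + 1))) \<and> \<sigma> m t = \<sigma> (\<sigma> v (2 * k + 1)) s))) \<and>
     (\<forall>k\<in>{..<n}.
        (\<forall>s<Suc (\<eta> (\<sigma> v (2 * k))). \<forall>t<Suc (\<eta> (\<sigma> v (2 * k + 1))).
            far (\<sigma> (\<sigma> v (2 * k)) s) (\<sigma> (\<sigma> v (2 * k + 1)) t)) \<and>
        (\<forall>s<Suc (\<eta> (\<sigma> v (2 * k))). \<forall>p\<in>P k. far (\<sigma> (\<sigma> v (2 * k)) s) p) \<and>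
        (\<forall>t<Suc (\<eta> (\<sigma> v (2 * k + 1))). \<forall>p\<in>Q k. far (\<sigma> (\<sigma> v (2 * k + 1)) t) p)))"
    (is "_ \<longleftrightarrow> (\<exists>m v. ?R m v)")
proof
  define el where "el = (\<lambda>j. \<sigma> j ` {..<Suc (\<eta> j)})"
  have union: "code_union \<sigma> \<eta> j = (\<Union>i\<in>el j. rb i)" for j
    unfolding code_union_def el_def by (intro arg_cong[of _ _ "\<lambda>F. \<Union>i\<in>F. rb i"]) auto
  have R: "?R m v \<longleftrightarrow> S \<subseteq> (\<Union>i\<in>el m. rb i) \<and>
      (\<forall>j\<in>el m. j \<in> W \<or> j = i \<or> (\<exists>k<n. j \<in> el (\<sigma> v (2 * k)) \<or> j \<in> el (\<sigma> v (2 * k + 1)))) \<and>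
      (\<forall>k<n. (\<forall>a\<in>el (\<sigma> v (2 * k)). \<forall>b\<in>el (\<sigma> v (2 * k + 1)). far a b) \<and>
        (\<forall>a\<in>el (\<sigma> v (2 * k)). \<forall>p\<in>P k. far a p) \<and> (\<forall>b\<in>el (\<sigma> v (2 * k + 1)). \<forall>p\<in>Q k. far b p))" for m v
    unfolding union unfolding el_def by (simp only: ball_simps image_iff) (simp add: Ball_def Bex_def)
  {
    assume "separation_criterion S n W P Q i"
    then obtain A B where AB: "\<forall>k<n. finite (A k) \<and> finite (B k) \<and> A k \<noteq> {} \<and> B k \<noteq> {} \<and>
         (\<forall>a\<in>A k. \<forall>b\<in>B k. far a b) \<and> (\<forall>a\<in>A k. \<forall>p\<in>P k. far a p) \<and> (\<forall>b\<in>B k. \<forall>p\<in>Q k. far b p)"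
      and cover: "S \<subseteq> (\<Union>j\<in>W. rb j) \<union> rb i \<union> (\<Union>k<n. (\<Union>j\<in>A k. rb j) \<union> (\<Union>j\<in>B k. rb j))"
      unfolding separation_criterion_def by (elim exE conjE)
    have code: "\<exists>j. el j = F" if F: "finite F" "F \<noteq> {}" for F
    proof -
      obtain l where l: "set l = F" using finite_list[OF F(1)] by blast
      then have "l \<in> range (\<lambda>j. map (\<sigma> j) [0..<Suc (\<eta> j)])" using F(2) range by auto
      then obtain j where "l = map (\<sigma> j) [0..<Suc (\<eta> j)]" by blast
      then have "el j = F" using l by (simp add: el_def atLeast0LessThan del: upt_Suc)
      then show ?thesis ..
    qed
    define G where "G = (\<lambda>t. if even t then A (t div 2) else B (t div 2))"
    have "finite (G t) \<and> G t \<noteq> {}" if "t < 2 * n" for t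
      using AB[rule_format, of "t div 2"] that by (auto simp: G_def)
    then have "\<forall>t. \<exists>j. t < 2 * n \<longrightarrow> el j = G t" using code by blast
    then obtain w where w: "\<And>t. t < 2 * n \<Longrightarrow> el (w t) = G t" by metis
    \<comment> \<open>The additional entry makes the list nonempty even when \<open>n = 0\<close>;
      its value is arbitrary.\<close>
    have "map w [0..<Suc (2 * n)] \<in> range (\<lambda>j. map (\<sigma> j) [0..<Suc (\<eta> j)])"
      unfolding range by simp
    then obtain v where v: "map w [0..<Suc (2 * n)] = map (\<sigma> v) [0..<Suc (\<eta> v)]" by blast
    have len: "\<eta> v = 2 * n" using arg_cong[OF v, of length] by (simp del: upt_Suc)
    have sv: "\<sigma> v t = w t" if "t \<le> 2 * n" for t
      using arg_cong[OF v, of "\<lambda>l. l ! t"] that by (simp add: len less_Suc_eq_le del: upt_Suc)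
    have el_v: "el (\<sigma> v (2 * k)) = A k" "el (\<sigma> v (2 * k + 1)) = B k" if "k < n" for k
    proof -
      have "2 * k < 2 * n" "2 * k + 1 < 2 * n" using that by auto
      then show "el (\<sigma> v (2 * k)) = A k" "el (\<sigma> v (2 * k + 1)) = B k"
        using w[of "2 * k"] w[of "2 * k + 1"] sv[of "2 * k"] sv[of "2 * k + 1"]
        by (simp_all add: G_def)
    qed
    \<comment> \<open>The hypothesis on \<open>S\<close> speaks of one code at a time, so a single
      \<open>m\<close> gathers all the balls of the cover; \<open>{i}\<close> makes the set
      nonempty.\<close>
    have "finite (W \<union> {i} \<union> (\<Union>k<n. A k \<union> B k))" using fin AB by simp
    from code[OF this] obtain m where m: "el m = W \<union> {i} \<union> (\<Union>k<n. A k \<union> B k)" by auto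
    have "?R m v"
      unfolding R m
    proof (intro conjI)
      show "S \<subseteq> (\<Union>i\<in>W \<union> {i} \<union> (\<Union>k<n. A k \<union> B k). rb i)" using cover by (simp add: UN_Un Un_ac)
          show "\<forall>j\<in>W \<union> {i} \<union> (\<Union>k<n. A k \<union> B k). j \<in> W \<or> j = i \<or>
          (\<exists>k<n. j \<in> el (\<sigma> v (2 * k)) \<or> j \<in> el (\<sigma> v (2 * k + 1)))"
        using el_v by blast
    qed (use el_v AB in simp)
    then show "\<exists>m v. ?R m v" by blast
  next
    assume "\<exists>m v. ?R m v"
    then obtain m v where mv: "?R m v" by blast
    note mv' = mv[unfolded R]
    have cover: "S \<subseteq> (\<Union>j\<in>W. rb j) \<union> rb i \<union>
        (\<Union>k<n. (\<Union>j\<in>el (\<sigma> v (2 * k)). rb j) \<union> (\<Union>j\<in>el (\<sigma> v (2 * k + 1)). rb j))"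
    proof
      fix x assume "x \<in> S"
      then obtain j where j: "j \<in> el m" "x \<in> rb j" using mv' by blast
      then consider "j \<in> W" | "j = i" | k where "k < n" "j \<in> el (\<sigma> v (2 * k)) \<or> j \<in> el (\<sigma> v (2 * k + 1))"
        using mv' by blast
      then show "x \<in> (\<Union>j\<in>W. rb j) \<union> rb i \<union>
        (\<Union>k<n. (\<Union>j\<in>el (\<sigma> v (2 * k)). rb j) \<union> (\<Union>j\<in>el (\<sigma> v (2 * k + 1)). rb j))"
        by cases (use j(2) in blast)+
    qed
    have ne: "finite (el j)" "el j \<noteq> {}" for j by (auto simp: el_def)
    show "separation_criterion S n W P Q i"
      unfolding separation_criterion_def
      by (rule exI[of _ "\<lambda>k. el (\<sigma> v (2 * k))"], rule exI[of _ "\<lambda>k. el (\<sigma> v (2 * k + 1))"])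
        (use ne cover mv' in simp)
  }
qed

text \<open>In coded form every quantifier is an existential one over numbers, a recursively bounded
  one, or one over a fixed finite set, and \<open>S\<close> occurs only in the enumerable statement
  that a code covers it.\<close>

lemma re_separation_criterion:
  assumes \<sigma>: "computable2 \<sigma>" and \<eta>: "computable1 \<eta>"
    and range: "range (\<lambda>j. map (\<sigma> j) [0..<Suc (\<eta> j)]) = {l. l \<noteq> []}"
    and far: "\<And>n f g. recursive n f \<Longrightarrow> recursive n g \<Longrightarrow> re n (\<lambda>xs. far (f xs) (g xs))"
    and cover: "ce_set {j. S \<subseteq> code_union \<sigma> \<eta> j}"
    and fin: "finite W" "\<And>k. k < n \<Longrightarrow> finite (P k) \<and> finite (Q k)"
  shows "re (Suc 0) (\<lambda>xs. separation_criterion S n W P Q (hd xs))"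
proof -
  have surj: "\<exists>c. map (\<sigma> c) [0..<length l] = l" for l
  \<comment> \<open>No code names the empty list, but it is the prefix of length 0 of any
    sequence.\<close>
  proof (cases "l = []")
    case False
    then have "l \<in> range (\<lambda>j. map (\<sigma> j) [0..<Suc (\<eta> j)])" unfolding range by simp
    then obtain j where j: "l = map (\<sigma> j) [0..<Suc (\<eta> j)]" by blast
    then have "length l = Suc (\<eta> j)" by (simp del: upt_Suc)
    then show ?thesis using j by metis
  qed simp
  have cover': "re m (\<lambda>xs. S \<subseteq> code_union \<sigma> \<eta> (f xs))" if "recursive m f" for m f
    using re_ce_set[OF \<sigma> surj cover that] by simp
  have P: "finite (P k)" "finite (Q k)" if "k \<in> {..<n}" for k using fin(2)[of k] that by auto
  show ?thesis
    unfolding separation_criterion_code[OF range fin(1)]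
    by (intro re_ex re_conj re_disj re_all_below re_bex_finite[OF fin(1)] re_bex_finite[OF finite_lessThan]
        re_ball_finite[OF finite_lessThan] re_ball_finite[OF P(1)] re_ball_finite[OF P(2)]
        re_eq re_less cover' far recursive_Suc recursive_vars recursive_const
        recursive_comp2[OF \<sigma>] recursive_comp1[OF \<eta>]) assumption+
qed

end

section \<open>Charts and the final compactness argument\<close>

lemma homeomorphic_Euclidean_space_homeomorphism:
  assumes "top_of_set N homeomorphic_space Euclidean_space n"
  obtains g h where "homeomorphism {u :: nat \<Rightarrow> real. \<forall>i\<ge>n. u i = 0} N g h"
proof -
  obtain h g where hg: "homeomorphic_maps (top_of_set N) (top_of_set {u :: nat \<Rightarrow> real. \<forall>i\<ge>n. u i = 0}) h g"
    using assms unfolding homeomorphic_space_def Euclidean_space_def euclidean_product_topology by blast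
  have "homeomorphism {u :: nat \<Rightarrow> real. \<forall>i\<ge>n. u i = 0} N g h"
    by (rule homeomorphismI)
      (use hg in \<open>simp_all add: homeomorphic_maps_def continuous_map_in_subtopology image_subset_iff_funcset\<close>)
  then show thesis by (rule that)
qed

theorem theorem6p3:
  fixes \<alpha> :: "nat \<Rightarrow> 'a::metric_space" and q :: "nat \<Rightarrow> rat"
    and \<tau>1 \<tau>2 \<eta> :: "nat \<Rightarrow> nat" and \<sigma> :: "nat \<Rightarrow> nat \<Rightarrow> nat" and S :: "'a set"
  assumes "computable_metric_space \<alpha>"
    and "admissible_numberings q \<tau>1 \<tau>2 \<sigma> \<eta>"
    and "semicomputable_compact \<alpha> q \<tau>1 \<tau>2 \<sigma> \<eta> S"
    and "manifold (top_of_set S)"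
  shows "computable_compact \<alpha> q \<tau>1 \<tau>2 \<sigma> \<eta> S"
proof -
  define radius where "radius = (\<lambda>i. real_of_rat (q (\<tau>2 i)))"
  have dense: "closure (range \<alpha>) = UNIV" and D: "computable_real2 (\<lambda>i j. dist (\<alpha> i) (\<alpha> j))"
    using assms(1) by (simp_all add: computable_metric_space_def)
  have q: "computable_rat_seq q" "range q = {r. r > 0}"
    and \<tau>: "computable1 \<tau>1" "computable1 \<tau>2" "range (\<lambda>i. (\<tau>1 i, \<tau>2 i)) = UNIV"
    and \<sigma>: "computable2 \<sigma>" "computable1 \<eta>" "range (\<lambda>j. map (\<sigma> j) [0..<Suc (\<eta> j)]) = {l. l \<noteq> []}"
    using assms(2) unfolding admissible_numberings_def by blast+
  interpret rational_balls "\<lambda>i. \<alpha> (\<tau>1 i)" radius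
  proof
    fix e :: real and x assume "e > 0"
    \<comment> \<open>The radius \<open>t\<close> is chosen before the centre, which is then taken
      within \<open>t\<close> of \<open>x\<close>; surjectivity onto pairs names the two by one
      index.\<close>
    then obtain t :: rat where t: "0 < real_of_rat t" "real_of_rat t < e" using of_rat_dense by blast
    then have "t \<in> range q" unfolding q(2) by simp
    then obtain k where k: "t = q k" by blast
    have "x \<in> closure (range \<alpha>)" using dense by simp
    then obtain a where a: "dist (\<alpha> a) x < real_of_rat t" using t(1)
      unfolding closure_approachable by blast
    have "(a, k) \<in> range (\<lambda>i. (\<tau>1 i, \<tau>2 i))" using \<tau>(3) by simp
    then obtain i where "\<tau>1 i = a" "\<tau>2 i = k" by blast
    then show "\<exists>i. dist (\<alpha> (\<tau>1 i)) x < radius i \<and> radius i < e"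
      using a t k by (intro exI[of _ i]) (simp add: radius_def)
  qed
  have rb: "rball \<alpha> q \<tau>1 \<tau>2 = rb" by (rule ext) (simp only: rball_def rb_def, simp only: radius_def)
  have union: "runion \<alpha> q \<tau>1 \<tau>2 \<sigma> \<eta> = code_union \<sigma> \<eta>"
    by (rule ext) (simp add: runion_def code_union_def rb)
  have far: "re n (\<lambda>xs. far (f xs) (g xs))" if "recursive n f" "recursive n g" for n f g
    unfolding far_def unfolding radius_def
    by (intro re_rat_sum_less_real[OF D q(1)] recursive_comp1[OF \<tau>(1)] recursive_comp1[OF \<tau>(2)] that)
  have S: "compact S" "ce_set {j. S \<subseteq> code_union \<sigma> \<eta> j}"
    using assms(3) by (simp_all add: semicomputable_compact_def union)
  obtain n where n: "\<And>x. x \<in> S \<Longrightarrow> \<exists>U N. openin (top_of_set S) U \<and> x \<in> U \<and> U \<subseteq> N \<and> N \<subseteq> S \<and>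
      subtopology (top_of_set S) N homeomorphic_space Euclidean_space n"
    using assms(4) unfolding manifold_def by auto
  \<comment> \<open>Neighbourhood and predicate are bundled so that one choice selects both.
    \<open>T\<close> is open in the whole space, the form in which compactness of \<open>S\<close>
    is applied.\<close>
  define good where "good = (\<lambda>x T C. open T \<and> x \<in> T \<and> re (Suc 0) (\<lambda>xs. C (hd xs)) \<and>
      (\<forall>i. C i \<longrightarrow> S \<inter> rb i \<noteq> {}) \<and> (\<forall>i. S \<inter> T \<inter> rb i \<noteq> {} \<longrightarrow> C i))"
  have "\<exists>T C. good x T C" if x: "x \<in> S" for x
  proof -
    obtain U N where UN: "openin (top_of_set S) U" "x \<in> U" "U \<subseteq> N" "N \<subseteq> S"
      "subtopology (top_of_set S) N homeomorphic_space Euclidean_space n" using n[OF x] by blast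
    have "subtopology (top_of_set S) N = top_of_set N"
      using UN(4) by (simp add: subtopology_subtopology Int_absorb1)
    then have "top_of_set N homeomorphic_space Euclidean_space n" using UN(5) by simp
    then obtain g h where hom: "homeomorphism {u :: nat \<Rightarrow> real. \<forall>i\<ge>n. u i = 0} N g h"
      by (rule homeomorphic_Euclidean_space_homeomorphism)
    obtain W P Q V where W: "finite W" "\<And>k. k < n \<Longrightarrow> finite (P k) \<and> finite (Q k)"
      and V: "openin (top_of_set S) V" "x \<in> V"
      and crit: "\<And>i. separation_criterion S n W P Q i \<Longrightarrow> S \<inter> rb i \<noteq> {}"
        "\<And>i. V \<inter> rb i \<noteq> {} \<Longrightarrow> separation_criterion S n W P Q i"
    proof (rule separation_criterion_chart[OF S(1) UN(1-4) hom], goal_cases)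
      case (1 W P Q V)
      show thesis by (rule 1(1)[OF 1(2-7)])
    qed
    obtain T where T: "open T" "V = S \<inter> T" using V(1) by (auto simp: openin_open)
    have "re (Suc 0) (\<lambda>xs. separation_criterion S n W P Q (hd xs))"
      by (rule re_separation_criterion[OF \<sigma> far S(2) W])
    moreover have "x \<in> T" using V(2) T(2) by blast
    ultimately show ?thesis
      using T(1) crit unfolding T(2) good_def
      by (intro exI[of _ T] exI[of _ "separation_criterion S n W P Q"] conjI allI impI)
  qed
  then obtain T C where "\<And>x. x \<in> S \<Longrightarrow> good x (T x) (C x)" by metis
  then have TC: "\<And>x. x \<in> S \<Longrightarrow> open (T x)" "\<And>x. x \<in> S \<Longrightarrow> x \<in> T x"
    "\<And>x. x \<in> S \<Longrightarrow> re (Suc 0) (\<lambda>xs. C x (hd xs))"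
    "\<And>x i. x \<in> S \<Longrightarrow> C x i \<Longrightarrow> S \<inter> rb i \<noteq> {}"
    "\<And>x i. x \<in> S \<Longrightarrow> S \<inter> T x \<inter> rb i \<noteq> {} \<Longrightarrow> C x i"
    unfolding good_def by simp_all
  obtain X where X: "X \<subseteq> S" "finite X" "S \<subseteq> (\<Union>x\<in>X. T x)"
  proof (rule compactE_image[OF S(1), of S T])
    show "S \<subseteq> (\<Union>x\<in>S. T x)" using TC(2) by blast
  qed (rule TC(1))
  have iff: "i \<in> {i. S \<inter> rb i \<noteq> {}} \<longleftrightarrow> (\<exists>x\<in>X. C x i)" for i
  proof
    assume "i \<in> {i. S \<inter> rb i \<noteq> {}}"
    then obtain y where y: "y \<in> S" "y \<in> rb i" by blast
    then obtain x where x: "x \<in> X" "y \<in> T x" using X(3) by blast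
    then have "S \<inter> T x \<inter> rb i \<noteq> {}" using y by blast
    then show "\<exists>x\<in>X. C x i" using TC(5)[of x i] x(1) X(1) by blast
  next
    assume "\<exists>x\<in>X. C x i"
    then show "i \<in> {i. S \<inter> rb i \<noteq> {}}" using TC(4) X(1) by blast
  qed
  have "re (Suc 0) (\<lambda>xs. \<exists>x\<in>X. C x (hd xs))"
    by (rule re_bex_finite[OF X(2)]) (use TC(3) X(1) in blast)
  then have "ce_set {i. S \<inter> rb i \<noteq> {}}"
    by (intro ce_set_if_re) (simp only: iff)
  then show ?thesis using assms(3) by (simp add: computable_compact_def rb)
qed

end
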